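(* There exists a unique linear map $\mathcal{B}^*:\mathbb{C}[M_{n,n}]\to \mathbf{U}(gl(n))$ such that $\mathcal{B}^*\big((S|T)^*\big)=[S|T]^*$ for every pair $S,T$ of Young tableaux on $\{1,\dots,n\}$ of the same shape.
   Context: $\mathbb{C}[M_{n,n}]$ is the polynomial algebra in the commuting indeterminates $(i|j)$, $1\le i,j\le n$ (identified with $\mathbf{Sym}(gl(n))$ via $e_{ij}\mapsto (i|j)$). A Young tableau $S$ of shape $\lambda=(\lambda_1\ge\dots\ge\lambda_m>0)$ on an alphabet is a sequence of words $(\omega_1,\dots,\omega_m)$ with $\ell(\omega_r)=\lambda_r$ (repetitions allowed). For words $\omega=i_1\cdots i_p$, $\varpi=j_1\cdots j_p$, the *-biproduct is the permanent $(\omega|\varpi)^*=\mathrm{per}\big((i_r|j_s)\big)_{r,s=1}^p$, and for $S=(\omega_1,\dots,\omega_m)$, $T=(\varpi_1,\dots,\varpi_m)$ of the same shape, $(S|T)^*=(\omega_1|\varpi_1)^*\cdots(\omega_m|\varpi_m)^*$. Capelli *-bitableaux (virtual variables). Let $A_0=\{\alpha_1,\dots,\alpha_{m_0}\}$ (positive virtual symbols, parity $0$), $A_1=\{\beta_1,\dots,\beta_{m_1}\}$ (negative virtual symbols, parity $1$), $L=\{1,\dots,n\}$ (proper symbols, parity $1$), with $m_0,m_1$ sufficiently large. Let $gl(m_0|m_1+n)$ be the Lie superalgebra with homogeneous basis $e_{a,b}$ ($a,b\in A_0\cup A_1\cup L$) of parity $|a|+|b|\bmod 2$ and superbracket $[e_{a,b},e_{c,d}]=\delta_{bc}e_{a,d}-(-1)^{(|a|+|b|)(|c|+|d|)}\delta_{ad}e_{c,b}$;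 the $e_{i,j}$, $i,j\in L$, span a copy of $gl(n)$, so $\mathbf{U}(gl(n))\subset\mathbf{U}(gl(m_0|m_1+n))$. A product $e_{a_m,b_m}\cdots e_{a_1,b_1}$ is irregular if there are $i\le m$ and $\gamma\in A_0\cup A_1$ with $\#\{j\le i: b_j=\gamma\}>\#\{j<i:a_j=\gamma\}$. Let $\mathbf{Irr}$ be the left ideal generated by irregular products. It is known that $\mathbf{U}(gl(n))+\mathbf{Irr}$ is a direct sum and a subalgebra $Virt$ in which $\mathbf{Irr}$ is a two-sided ideal; $\mathfrak p:Virt\to\mathbf{U}(gl(n))$ is the projection with kernel $\mathbf{Irr}$. For tableaux $S,T$ of the same shape, $e_{S,T}$ is the product, over rows from first to last and within each row from left to right, of $e_{s,t}$ with $s,t$ corresponding entries. For a shape $\lambda$ with $m$ rows, $D'_\lambda$ is the tableau of shape $\lambda$ whose $r$-th row is $\beta_r$ repeated $\lambda_r$ times. The Capelli *-bitableau is $[S|T]^*=\mathfrak p(e_{S,D'_\lambda}e_{D'_\lambda,T})\in\mathbf{U}(gl(n))$. *)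

theory Defs
  imports Complex_Main "HOL-Library.Poly_Mapping" "HOL-Combinatorics.Permutations"
begin

type_synonym mpoly = "((nat \<times> nat) \<Rightarrow>\<^sub>0 nat) \<Rightarrow>\<^sub>0 complex"

definition pvar :: "nat \<Rightarrow> nat \<Rightarrow> mpoly" where
  "pvar i j = Poly_Mapping.single (Poly_Mapping.single (i, j) 1) 1"

definition psmult :: "complex \<Rightarrow> mpoly \<Rightarrow> mpoly" where
  "psmult c p = Poly_Mapping.map (\<lambda>x. c * x) p"

definition Pn :: "nat \<Rightarrow> mpoly set" where
  "Pn n = {p. \<forall>m \<in> Poly_Mapping.keys p. Poly_Mapping.keys m \<subseteq> {1..n} \<times> {1..n}}"

definition per_biprod :: "nat list \<Rightarrow> nat list \<Rightarrow> mpoly" where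
  "per_biprod w v = (\<Sum>\<sigma> \<in> {\<sigma>. \<sigma> permutes {..<length w}}.
      \<Prod>r<length w. pvar (w ! r) (v ! (\<sigma> r)))"

definition star_bitab :: "nat list list \<Rightarrow> nat list list \<Rightarrow> mpoly" where
  "star_bitab S T = (\<Prod>r<length S. per_biprod (S ! r) (T ! r))"

definition young_tableau :: "nat \<Rightarrow> nat list list \<Rightarrow> bool" where
  "young_tableau n S \<longleftrightarrow> sorted_wrt (\<ge>) (map length S) \<and>
     (\<forall>w \<in> set S. w \<noteq> [] \<and> set w \<subseteq> {1..n})"

definition shape :: "nat list list \<Rightarrow> nat list" where
  "shape S = map length S"

section \<open>The universal enveloping superalgebra U(gl(m_0|m_1+n)) with infinitely many virtual symbols\<close>

datatype sym = Alpha nat | Beta nat | Prop nat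

fun par :: "sym \<Rightarrow> nat" where
  "par (Alpha _) = 0" | "par (Beta _) = 1" | "par (Prop _) = 1"

fun virtual :: "sym \<Rightarrow> bool" where
  "virtual (Prop _) = False" | "virtual _ = True"

definition Syms :: "nat \<Rightarrow> sym set" where
  "Syms n = range Alpha \<union> range Beta \<union> Prop ` {1..n}"

type_synonym letter = "sym \<times> sym"   \<comment> \<open>(a,b) stands for e_{a,b}\<close>

definition letters :: "nat \<Rightarrow> letter set" where
  "letters n = Syms n \<times> Syms n"

definition lpar :: "letter \<Rightarrow> nat" where
  "lpar x = (par (fst x) + par (snd x)) mod 2"

text \<open>Free associative algebra on the letters: finite linear combinations of words;
  the word [x1,...,xk] stands for the product x1 x2 ... xk.\<close>
type_synonym fa = "letter list \<Rightarrow>\<^sub>0 complex"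

definition fw :: "letter list \<Rightarrow> fa" where
  "fw w = Poly_Mapping.single w 1"

definition fsc :: "complex \<Rightarrow> fa \<Rightarrow> fa" where
  "fsc c f = Poly_Mapping.map (\<lambda>x. c * x) f"

definition fmul :: "fa \<Rightarrow> fa \<Rightarrow> fa" where
  "fmul f g = (\<Sum>u \<in> Poly_Mapping.keys f. \<Sum>v \<in> Poly_Mapping.keys g.
       Poly_Mapping.single (u @ v) (Poly_Mapping.lookup f u * Poly_Mapping.lookup g v))"

text \<open>Defining relation of U: x y - (-1)^{|x||y|} y x - [x,y], with the superbracket
  [e_{a,b}, e_{c,d}] = delta_{bc} e_{a,d} - (-1)^{|x||y|} delta_{ad} e_{c,b}.\<close>
definition urel :: "letter \<Rightarrow> letter \<Rightarrow> fa" where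
  "urel x y = (let s = (-1::complex) ^ (lpar x * lpar y) in
     fw [x, y] - fsc s (fw [y, x])
     - ((if snd x = fst y then fw [(fst x, snd y)] else 0)
        - fsc s (if fst x = snd y then fw [(fst y, snd x)] else 0)))"

definition words :: "nat \<Rightarrow> letter list set" where
  "words n = {w. set w \<subseteq> letters n}"

inductive_set UId :: "nat \<Rightarrow> fa set" for n where
  UId_zero: "0 \<in> UId n"
| UId_gen: "u \<in> words n \<Longrightarrow> v \<in> words n \<Longrightarrow> x \<in> letters n \<Longrightarrow> y \<in> letters n \<Longrightarrow>
     fmul (fmul (fw u) (urel x y)) (fw v) \<in> UId n"
| UId_add: "p \<in> UId n \<Longrightarrow> q \<in> UId n \<Longrightarrow> p + q \<in> UId n"
| UId_smult: "p \<in> UId n \<Longrightarrow> fsc c p \<in> UId n"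

text \<open>Irregular products.  The word w represents e_{a_m,b_m} ... e_{a_1,b_1}, so
  rev w lists the factors e_{a_1,b_1}, ..., e_{a_m,b_m}.\<close>
definition irregular :: "letter list \<Rightarrow> bool" where
  "irregular w \<longleftrightarrow> (\<exists>k < length w. \<exists>\<gamma>. virtual \<gamma> \<and>
      length (filter (\<lambda>x. snd x = \<gamma>) (take (Suc k) (rev w)))
        > length (filter (\<lambda>x. fst x = \<gamma>) (take k (rev w))))"

text \<open>Preimage in the free algebra of the left ideal Irr of U generated by irregular products.\<close>
inductive_set IrrS :: "nat \<Rightarrow> fa set" for n where
  IrrS_UId: "p \<in> UId n \<Longrightarrow> p \<in> IrrS n"
| IrrS_gen: "u \<in> words n \<Longrightarrow> w \<in> words n \<Longrightarrow> irregular w \<Longrightarrow> fw (u @ w) \<in> IrrS n"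
| IrrS_add: "p \<in> IrrS n \<Longrightarrow> q \<in> IrrS n \<Longrightarrow> p + q \<in> IrrS n"
| IrrS_smult: "p \<in> IrrS n \<Longrightarrow> fsc c p \<in> IrrS n"

text \<open>Representatives of U(gl(n)): combinations of words in the e_{i,j}, i,j in {1..n}.\<close>
definition GLW :: "nat \<Rightarrow> fa set" where
  "GLW n = {f. \<forall>w \<in> Poly_Mapping.keys f. \<forall>x \<in> set w.
     fst x \<in> Prop ` {1..n} \<and> snd x \<in> Prop ` {1..n}}"

text \<open>The projection p : Virt -> U(gl(n)) with kernel Irr (on representatives).\<close>
definition proj :: "nat \<Rightarrow> fa \<Rightarrow> fa" where
  "proj n v = (SOME u. u \<in> GLW n \<and> v - u \<in> IrrS n)"

text \<open>e_{S,D'_lambda} and e_{D'_lambda,T}; row r (0-based) of D'_lambda is beta_{r+1}.\<close>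
definition e_SD :: "nat list list \<Rightarrow> letter list" where
  "e_SD S = concat (map (\<lambda>r. map (\<lambda>s. (Prop s, Beta (Suc r))) (S ! r)) [0..<length S])"

definition e_DT :: "nat list list \<Rightarrow> letter list" where
  "e_DT T = concat (map (\<lambda>r. map (\<lambda>t. (Beta (Suc r), Prop t)) (T ! r)) [0..<length T])"

definition capelli_bitab :: "nat \<Rightarrow> nat list list \<Rightarrow> nat list list \<Rightarrow> fa" where
  "capelli_bitab n S T = proj n (fmul (fw (e_SD S)) (fw (e_DT T)))"

text \<open>A map C[M_{n,n}] -> U(gl(n)), given on representatives: values in GLW n and
  linear modulo the defining ideal of U.\<close>
definition lin_to_Ugl :: "nat \<Rightarrow> (mpoly \<Rightarrow> fa) \<Rightarrow> bool" where
  "lin_to_Ugl n B \<longleftrightarrow> (\<forall>p \<in> Pn n. B p \<in> GLW n) \<and>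
     (\<forall>p \<in> Pn n. \<forall>q \<in> Pn n. B (p + q) - (B p + B q) \<in> UId n) \<and>
     (\<forall>c. \<forall>p \<in> Pn n. B (psmult c p) - fsc c (B p) \<in> UId n)"

end

(*
  U(gl(m_0|m_1+n)) acts on the tensor powers of its defining representation, and Irr annihilates
  every tensor that contains only proper symbols.  On such tensors U(gl(n)) acts faithfully: words
  expand into normal ordered products, these are linearly independent, and words with the same
  letters agree in U(gl(n)) up to shorter words.  So an identity between elements of U(gl(n)) can be
  checked on proper tensors, where p(v) acts like v.  There the e_{s,beta} must consume exactly the
  symbols beta that the e_{beta,t} have created, in all ways compatible with the rows, and
  e_{S,D'} e_{D',T} therefore acts as the normal ordered product attached to the polynomial (S|T)*.
  This depends only on the polynomial and is linear in it.  Uniqueness holds because every monomial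
  is (S|T)* for tableaux with a single column.
*)
theory Submission
  imports Defs
begin

text \<open>The projection is a \<open>SOME\<close> choice, so it says nothing until a
  representative in \<open>GLW n\<close> exists. A degree that counts virtual symbols supplies one:
  modulo Irr, a word of degree zero reduces to words in the letters of gl(n). Two choices differ by
  an element of Irr in \<open>GLW n\<close>, which kills proper tensors and hence lies in
  \<open>UId n\<close> by faithfulness. Faithfulness thereby takes the place of the
  Poincare-Birkhoff-Witt theorem. Signs matter only while the defining relations are shown to act by
  zero. The letters of e_{S,D'} and e_{D',T} join negative and proper symbols, which are both odd,
  so these letters are even. Their contractions carry no sign, and a row contributes a permanent
  instead of a determinant.\<close>

abbreviation "coef \<equiv> Poly_Mapping.lookup"
abbreviation "supp \<equiv> Poly_Mapping.keys"
abbreviation "sngl \<equiv> Poly_Mapping.single"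

text \<open>Polymorphic in the basis because three bases are extended this way: words
  (\<open>fa_act\<close>), multisets of letters (\<open>normal_ord_independent\<close>) and
  monomials (\<open>poly_act\<close>).\<close>

definition linext :: "('a \<Rightarrow> complex) \<Rightarrow> ('a \<Rightarrow>\<^sub>0 complex) \<Rightarrow> complex" where
  "linext h f = (\<Sum>w\<in>supp f. coef f w * h w)"

lemma coef_scale: "coef (Poly_Mapping.map (\<lambda>x. c * x) f) w = c * coef f (w::'a)" for c :: complex
  by transfer (auto simp: when_def)

lemma coef_fsc [simp]: "coef (fsc c f) w = c * coef f w"
  unfolding fsc_def by (rule coef_scale)

lemma supp_fsc: "supp (fsc c f) \<subseteq> supp f"
  by (auto simp: in_keys_iff)

lemma linext_superset:
  assumes "finite A" "supp f \<subseteq> A"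
  shows "linext h f = (\<Sum>w\<in>A. coef f w * h w)"
  unfolding linext_def using assms by (intro sum.mono_neutral_left) (auto simp: in_keys_iff)

lemma linext_zero [simp]: "linext h 0 = 0"
  by (simp add: linext_def)

lemma linext_single [simp]: "linext h (sngl w c) = c * h w"
  by (subst linext_superset[of "{w}"]) auto

lemma linext_add [simp]: "linext h (f + g) = linext h f + linext h g"
proof -
  have "supp (f + g) \<subseteq> supp f \<union> supp g" by (rule Poly_Mapping.keys_add)
  then show ?thesis
    by (simp add: linext_superset[of "supp f \<union> supp g"] lookup_add algebra_simps sum.distrib)
qed

lemma linext_scale [simp]: "linext h (Poly_Mapping.map (\<lambda>x. c * x) f) = c * linext h f"
  by (subst linext_superset[of "supp f"])
     (auto simp: linext_def in_keys_iff coef_scale sum_distrib_left mult.assoc)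

lemma linext_fsc [simp]: "linext h (fsc c f) = c * linext h f"
  unfolding fsc_def by (rule linext_scale)

lemma linext_diff [simp]: "linext h (f - g) = linext h f - linext h g"
  by (metis add_diff_cancel_right' diff_add_cancel linext_add)

lemma linext_sum [simp]: "linext h (sum F A) = (\<Sum>i\<in>A. linext h (F i))"
  by (induction A rule: infinite_finite_induct) auto

lemma linext_cong: "(\<And>w. w \<in> supp f \<Longrightarrow> h w = h' w) \<Longrightarrow> linext h f = linext h' f"
  unfolding linext_def by simp

section \<open>Monomial expansion and arithmetic of the free algebra\<close>

lemma sum_monomials: "f = (\<Sum>w\<in>supp f. sngl w (coef f w))" for f :: "'a \<Rightarrow>\<^sub>0 complex"
proof (rule poly_mapping_eqI)
  fix v
  have "(\<Sum>w\<in>supp f. coef (sngl w (coef f w)) v) = (\<Sum>w\<in>supp f. if w = v then coef f w else 0)"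
    by (intro sum.cong) (auto simp: lookup_single when_def)
  also have "\<dots> = coef f v" by (simp add: in_keys_iff)
  finally show "coef f v = coef (\<Sum>w\<in>supp f. sngl w (coef f w)) v"
    by (simp add: lookup_sum)
qed

text \<open>\<open>fmul\<close> sums over the supports of its arguments, and these may change under
  addition and scaling. Fixed finite index sets turn bilinearity into a termwise
  computation.\<close>

lemma fmul_superset:
  assumes "finite A" "supp f \<subseteq> A" "finite B" "supp g \<subseteq> B"
  shows "fmul f g = (\<Sum>u\<in>A. \<Sum>v\<in>B. sngl (u @ v) (coef f u * coef g v))"
proof -
  have "fmul f g = (\<Sum>u\<in>supp f. \<Sum>v\<in>B. sngl (u @ v) (coef f u * coef g v))"
    unfolding fmul_def using assms
    by (intro sum.cong refl sum.mono_neutral_left) (auto simp: in_keys_iff)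
  also have "\<dots> = (\<Sum>u\<in>A. \<Sum>v\<in>B. sngl (u @ v) (coef f u * coef g v))"
    using assms by (intro sum.mono_neutral_left) (auto simp: in_keys_iff)
  finally show ?thesis .
qed

lemma fmul_fw [simp]: "fmul (fw u) (fw v) = fw (u @ v)"
  unfolding fw_def by (subst fmul_superset[of "{u}" _ "{v}"]) auto

lemma fmul_add_right: "fmul f (g + h) = fmul f g + fmul f h"
proof -
  let ?B = "supp g \<union> supp h"
  have "supp (g + h) \<subseteq> ?B" by (rule Poly_Mapping.keys_add)
  then show ?thesis
    by (simp add: fmul_superset[of "supp f" f ?B] lookup_add algebra_simps single_add sum.distrib)
qed

lemma fmul_add_left: "fmul (f + g) h = fmul f h + fmul g h"
proof -
  let ?A = "supp f \<union> supp g"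
  have "supp (f + g) \<subseteq> ?A" by (rule Poly_Mapping.keys_add)
  then show ?thesis
    by (simp add: fmul_superset[of ?A _ "supp h"] lookup_add algebra_simps single_add sum.distrib)
qed

lemma fsc_sngl [simp]: "fsc c (sngl w d) = sngl w (c * d)"
  by (rule poly_mapping_eqI) (simp add: lookup_single when_def)

lemma fsc_add: "fsc c (f + g) = fsc c f + fsc c g"
  by (rule poly_mapping_eqI) (simp add: lookup_add algebra_simps)

lemma fsc_diff: "fsc c (f - g) = fsc c f - fsc c g"
  by (rule poly_mapping_eqI) (simp add: lookup_minus algebra_simps)

lemma fsc_zero [simp]: "fsc c 0 = 0"
  by (rule poly_mapping_eqI) simp

lemma fsc_0_left [simp]: "fsc 0 f = 0"
  by (rule poly_mapping_eqI) simp

lemma fsc_one [simp]: "fsc 1 f = f"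
  by (rule poly_mapping_eqI) simp

lemma fsc_fsc [simp]: "fsc c (fsc d f) = fsc (c * d) f"
  by (rule poly_mapping_eqI) simp

lemma fsc_add_left: "fsc (c + d) f = fsc c f + fsc d f"
  by (rule poly_mapping_eqI) (simp add: lookup_add algebra_simps)

lemma fsc_minus_one: "fsc (-1) f = - f"
  by (rule poly_mapping_eqI) simp

lemma fsc_sum: "fsc c (sum F A) = (\<Sum>i\<in>A. fsc c (F i))"
  by (induction A rule: infinite_finite_induct) (auto simp: fsc_add)

lemma fmul_fsc_right: "fmul f (fsc c g) = fsc c (fmul f g)"
  by (subst fmul_superset[of "supp f" _ "supp g"], simp_all add: supp_fsc)
     (simp add: fmul_def fsc_sum mult_ac)

lemma fmul_fsc_left: "fmul (fsc c f) g = fsc c (fmul f g)"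
  by (subst fmul_superset[of "supp f" _ "supp g"], simp_all add: supp_fsc)
     (simp add: fmul_def fsc_sum mult_ac)

lemma fmul_diff_right: "fmul f (g - h) = fmul f g - fmul f h"
  by (metis add_diff_cancel_right' diff_add_cancel fmul_add_right)

lemma fmul_diff_left: "fmul (f - g) h = fmul f h - fmul g h"
  by (metis add_diff_cancel_right' diff_add_cancel fmul_add_left)

lemma fmul_zero [simp]: "fmul f 0 = 0" "fmul 0 f = 0"
  by (simp_all add: fmul_def)

text \<open>A defining relation with context on both sides, spelled out in words: the form in which
  the action and the inductions over words can use the generators of \<open>UId\<close>.\<close>

definition urel_in :: "letter list \<Rightarrow> letter \<Rightarrow> letter \<Rightarrow> letter list \<Rightarrow> fa" where
  "urel_in u x y v = (let s = (-1::complex) ^ (lpar x * lpar y) in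
     fw (u @ x # y # v) - fsc s (fw (u @ y # x # v))
     - ((if snd x = fst y then fw (u @ (fst x, snd y) # v) else 0)
        - fsc s (if fst x = snd y then fw (u @ (fst y, snd x) # v) else 0)))"

lemma fmul_urel: "fmul (fmul (fw u) (urel x y)) (fw v) = urel_in u x y v"
  by (simp add: urel_def urel_in_def Let_def fmul_diff_left fmul_diff_right fmul_fsc_left fmul_fsc_right)

lemma urel_in_UId:
  "\<lbrakk>u \<in> words n; v \<in> words n; x \<in> letters n; y \<in> letters n\<rbrakk> \<Longrightarrow> urel_in u x y v \<in> UId n"
  using UId_gen[of u n v x y] by (simp add: fmul_urel)

lemma UId_uminus: "p \<in> UId n \<Longrightarrow> - p \<in> UId n"
  using UId_smult[of p n "-1"] by (simp add: fsc_minus_one)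

lemma UId_sum: "(\<And>i. i \<in> A \<Longrightarrow> F i \<in> UId n) \<Longrightarrow> sum F A \<in> UId n"
  by (induction A rule: infinite_finite_induct) (auto intro: UId_zero UId_add)

lemma GLW_zero [simp]: "0 \<in> GLW n"
  by (simp add: GLW_def)

lemma GLW_add: "p \<in> GLW n \<Longrightarrow> q \<in> GLW n \<Longrightarrow> p + q \<in> GLW n"
  unfolding GLW_def using Poly_Mapping.keys_add[of p q] by blast

lemma GLW_smult: "p \<in> GLW n \<Longrightarrow> fsc c p \<in> GLW n"
  unfolding GLW_def using supp_fsc[of c p] by blast

lemma GLW_diff: "p \<in> GLW n \<Longrightarrow> q \<in> GLW n \<Longrightarrow> p - q \<in> GLW n"
  using GLW_add[OF _ GLW_smult[of q n "-1"], of p] by (simp add: fsc_minus_one)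

lemma GLW_sum: "(\<And>i. i \<in> A \<Longrightarrow> F i \<in> GLW n) \<Longrightarrow> sum F A \<in> GLW n"
  by (induction A rule: infinite_finite_induct) (auto intro: GLW_add)

section \<open>The action on tensors\<close>

text \<open>\<open>letter_act x g\<close> is the functional \<open>g\<close> composed with the superderivation action of \<open>e\<^sub>x\<close> on
  tensors of basis vectors. Working on the dual side turns operators into total functions and
  reverses the order of products: \<open>word_act (u @ v) g = word_act v (word_act u g)\<close>.\<close>
fun letter_act :: "letter \<Rightarrow> (sym list \<Rightarrow> complex) \<Rightarrow> sym list \<Rightarrow> complex" where
  "letter_act x g [] = 0"
| "letter_act x g (s # l) = (if s = snd x then g (fst x # l) else 0)
     + (-1) ^ (lpar x * par s) * letter_act x (\<lambda>l'. g (s # l')) l"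

primrec word_act :: "letter list \<Rightarrow> (sym list \<Rightarrow> complex) \<Rightarrow> sym list \<Rightarrow> complex" where
  "word_act [] g = g"
| "word_act (x # w) g = word_act w (letter_act x g)"

definition fa_act :: "fa \<Rightarrow> (sym list \<Rightarrow> complex) \<Rightarrow> sym list \<Rightarrow> complex" where
  "fa_act f g l = linext (\<lambda>w. word_act w g l) f"

lemma fa_act_simps [simp]:
  "fa_act 0 g l = 0"
  "fa_act (p + q) g l = fa_act p g l + fa_act q g l"
  "fa_act (p - q) g l = fa_act p g l - fa_act q g l"
  "fa_act (fsc c p) g l = c * fa_act p g l"
  "fa_act (sum F A) g l = (\<Sum>i\<in>A. fa_act (F i) g l)"
  "fa_act (fw w) g l = word_act w g l"
  by (simp_all add: fa_act_def fw_def)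

lemma letter_act_zero [simp]: "letter_act x (\<lambda>l. 0) l = 0"
  by (induction l) auto

lemma letter_act_add [simp]: "letter_act x (\<lambda>l. g l + h l) l = letter_act x g l + letter_act x h l"
  by (induction l arbitrary: g h) (auto simp: distrib_left)

lemma letter_act_scale [simp]: "letter_act x (\<lambda>l. c * g l) l = c * letter_act x g l"
  by (induction l arbitrary: g) (auto simp: distrib_left)

lemma letter_act_diff [simp]: "letter_act x (\<lambda>l. g l - h l) l = letter_act x g l - letter_act x h l"
  using letter_act_add[of x "\<lambda>l. g l - h l" h l] by (simp)

lemma word_act_lin [simp]:
  "word_act w (\<lambda>l. 0) l = 0"
  "word_act w (\<lambda>l. g l + h l) l = word_act w g l + word_act w h l"
  "word_act w (\<lambda>l. g l - h l) l = word_act w g l - word_act w h l"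
  "word_act w (\<lambda>l. c * g l) l = c * word_act w g l"
proof (induction w arbitrary: g h)
  case (Cons x w)
  { case 1 show ?case using Cons.IH(1) by (simp add: letter_act_zero[abs_def]) 
  next case 2 show ?case using Cons.IH(2) by (simp add: letter_act_add[abs_def])
  next case 3 show ?case using Cons.IH(3) by (simp add: letter_act_diff[abs_def])
  next case 4 show ?case using Cons.IH(4) by (simp add: letter_act_scale[abs_def])
  }
qed simp_all

lemma word_act_append: "word_act (u @ v) g = word_act v (word_act u g)"
  by (induction u arbitrary: g) auto

lemma par_cases: "par s = 0 \<or> par s = 1"
  by (cases s) auto

text \<open>The sign bookkeeping in the induction step of \<open>letter_act_bracket\<close>.\<close>
lemma bracket_step_identity:
  fixes e xc xs ya ys P Q A C X Y ga gc :: complex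
  assumes "P = e * Q + (if bc then A else 0) - e * (if ad then C else 0)"
    and xc: "sd \<Longrightarrow> xc = e * xs" and ys: "sb \<Longrightarrow> ys = ya * e"
  shows "((if sd then (if bc then ga else 0) + xc * X else 0) + ys * ((if sb then Y else 0) + xs * P))
    - e * ((if sb then (if ad then gc else 0) + ya * Y else 0) + xs * ((if sd then X else 0) + ys * Q))
   = (if bc then (if sd then ga else 0) + xs * ys * A else 0)
    - e * (if ad then (if sb then gc else 0) + xs * ys * C else 0)"
  unfolding assms(1)
  by (cases sd; cases sb) (auto simp: xc ys algebra_simps)

text \<open>On the dual side the product xy is \<open>letter_act x\<close> followed by
  \<open>letter_act y\<close>. Split off the first factor s of the tensor: both letters on s give
  the bracket on s, both on the tail give the induction hypothesis, and the mixed terms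
  cancel.\<close>

lemma letter_act_bracket:
  "letter_act y (letter_act x g) l - (-1) ^ (lpar x * lpar y) * letter_act x (letter_act y g) l
   = (if snd x = fst y then letter_act (fst x, snd y) g l else 0)
     - (-1) ^ (lpar x * lpar y) * (if fst x = snd y then letter_act (fst y, snd x) g l else 0)"
proof (induction l arbitrary: g)
  case Nil
  then show ?case by simp
next
  case (Cons s l)
  obtain a b where x: "x = (a, b)" by (cases x)
  obtain c d where y: "y = (c, d)" by (cases y)
  define G where "G = (\<lambda>l'. g (s # l'))"
  have rearrange: "p - q = u - v \<Longrightarrow> p = q + u - v" for p q u v :: complex
    by (simp add: algebra_simps)
  have IH: "letter_act (c, d) (letter_act (a, b) G) l =
      (-1) ^ (lpar (a, b) * lpar (c, d)) * letter_act (a, b) (letter_act (c, d) G) l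
      + (if b = c then letter_act (a, d) G l else 0)
      - (-1) ^ (lpar (a, b) * lpar (c, d)) * (if a = d then letter_act (c, b) G l else 0)"
    by (rule rearrange[OF Cons.IH[of G, unfolded x y fst_conv snd_conv]])
  have xy: "letter_act x (\<lambda>l'. letter_act y g (s # l')) l = (if s = d then letter_act x (\<lambda>l'. g (c # l')) l else 0)
      + (-1) ^ (lpar y * par s) * letter_act x (letter_act y G) l" 
   and yx: "letter_act y (\<lambda>l'. letter_act x g (s # l')) l = (if s = b then letter_act y (\<lambda>l'. g (a # l')) l else 0)
      + (-1) ^ (lpar x * par s) * letter_act y (letter_act x G) l"
    by (simp_all add: x y G_def)
  \<comment> \<open>A letter changes the parity of the symbol that it replaces by its own parity, so
    the signs of the mixed terms agree (\<open>s1\<close>, \<open>s2\<close>). In \<open>s3\<close>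
    the two signs for passing s combine to that of the bracket, whose parity is |x| + |y|.\<close>
  have s1: "(-1::complex) ^ (lpar x * par c) = (-1) ^ (lpar x * lpar y) * (-1) ^ (lpar x * par d)"
   and s2: "(-1::complex) ^ (lpar y * par a) * (-1) ^ (lpar x * lpar y) = (-1) ^ (lpar y * par b)"
   and s3: "(-1::complex) ^ (lpar x * par s) * (-1) ^ (lpar y * par s) = (-1) ^ (((par a + par b + par c + par d) mod 2) * par s)"
    using par_cases[of a] par_cases[of b] par_cases[of c] par_cases[of d] par_cases[of s]
    by (auto simp: x y lpar_def)
  have sb: "lpar (a, d) = (par a + par b + par c + par d) mod 2" if "b = c"
    using par_cases[of b] by (auto simp: lpar_def that)
  have sa: "lpar (c, b) = (par a + par b + par c + par d) mod 2" if "a = d"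
    using par_cases[of d] by (auto simp: lpar_def that add_ac)
  have L1: "letter_act y (letter_act x g) (s # l) = 
      (if s = d then (if b = c then g (a # l) else 0) 
        + (-1) ^ (lpar x * par c) * letter_act x (\<lambda>l'. g (c # l')) l else 0)
      + (-1) ^ (lpar y * par s) * ((if s = b then letter_act y (\<lambda>l'. g (a # l')) l else 0)
      + (-1) ^ (lpar x * par s) * letter_act y (letter_act x G) l)"
    unfolding letter_act.simps(2)[of y] yx by (simp add: x y eq_commute[of c b])
  have L2: "letter_act x (letter_act y g) (s # l) = 
      (if s = b then (if a = d then g (c # l) else 0) 
        + (-1) ^ (lpar y * par a) * letter_act y (\<lambda>l'. g (a # l')) l else 0)
      + (-1) ^ (lpar x * par s) * ((if s = d then letter_act x (\<lambda>l'. g (c # l')) l else 0)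
      + (-1) ^ (lpar y * par s) * letter_act x (letter_act y G) l)"
    unfolding letter_act.simps(2)[of x] xy by (simp add: x y)
  have R1: "(if b = c then letter_act (a, d) g (s # l) else 0) = 
      (if b = c then (if s = d then g (a # l) else 0) + (-1) ^ (lpar x * par s) * (-1) ^ (lpar y * par s) * letter_act (a, d) G l else 0)"
    unfolding s3 by (simp add: sb G_def)
  have R2: "(if a = d then letter_act (c, b) g (s # l) else 0) = 
      (if a = d then (if s = b then g (c # l) else 0) + (-1) ^ (lpar x * par s) * (-1) ^ (lpar y * par s) * letter_act (c, b) G l else 0)"
    unfolding s3 by (simp add: sa G_def)
  have s1': "(-1::complex) ^ (lpar x * par c) = (-1) ^ (lpar x * lpar y) * (-1) ^ (lpar x * par s)" if "s = d"
    using s1 that by simp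
  have s2': "(-1::complex) ^ (lpar y * par s) = (-1) ^ (lpar y * par a) * (-1) ^ (lpar x * lpar y)" if "s = b"
    using s2 that by simp
  show ?case
    unfolding L1 L2 unfolding x y fst_conv snd_conv R1[unfolded x y] R2[unfolded x y]
    by (rule bracket_step_identity[OF IH s1'[unfolded x y] s2'[unfolded x y]])
qed

lemma urel_in_act: "fa_act (urel_in u x y v) g l = 0"
proof -
  let ?h = "word_act u g" and ?e = "(-1::complex) ^ (lpar x * lpar y)"
  have "fa_act (urel_in u x y v) g l = word_act v (\<lambda>l. letter_act y (letter_act x ?h) l 
     - ?e * letter_act x (letter_act y ?h) l
     - ((if snd x = fst y then letter_act (fst x, snd y) ?h l else 0)
     - ?e * (if fst x = snd y then letter_act (fst y, snd x) ?h l else 0))) l"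
    by (auto simp: urel_in_def Let_def word_act_append word_act_lin(3,4))
  also have "\<dots> = 0"
    by (subst letter_act_bracket) simp
  finally show ?thesis .
qed

section \<open>Vanishing of the relations and of the irregular products\<close>

lemma UId_act: "p \<in> UId n \<Longrightarrow> fa_act p g l = 0"
  by (induction rule: UId.induct) (auto simp: fmul_urel urel_in_act)

text \<open>\<open>letter_act x g l\<close> is a signed sum of values of \<open>g\<close> at lists
  that arise from \<open>l\<close> by one replacement, so arguments for vanishing can ignore the
  signs.\<close>

lemma letter_act_count:
  assumes "\<And>l'. (\<exists>q q'. l' = q @ fst x # q' \<and> l = q @ snd x # q') \<Longrightarrow> g l' = 0"
  shows "letter_act x g l = 0"
  using assms
proof (induction l arbitrary: g)
  case (Cons s l)
  have "letter_act x (\<lambda>l'. g (s # l')) l = 0"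
    by (rule Cons.IH) (metis Cons.prems append_Cons)
  moreover have "s = snd x \<longrightarrow> g (fst x # l) = 0"
    using Cons.prems[of "fst x # l"] by (metis append_Nil)
  ultimately show ?case by simp
qed simp

text \<open>A balance of copies of \<gamma>: those in \<open>l\<close> and those created by
  \<open>w\<close> do not cover what \<open>x # w\<close> has to remove. The induction peels off the
  rightmost factor, which meets the tensor first; its replacement in \<open>l\<close> preserves the
  deficit.\<close>

lemma irregular_suffix_act:
  assumes "length (filter (\<lambda>y. snd y = \<gamma>) (x # w)) > length (filter (\<lambda>y. fst y = \<gamma>) w) + count_list l \<gamma>"
  shows "word_act (x # w) g l = 0"
  using assms
proof (induction w arbitrary: l rule: rev_induct)
  case Nil
  then have "\<gamma> \<notin> set l" "snd x = \<gamma>" by (auto split: if_splits simp: count_list_0_iff)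
  then show ?case by (auto intro!: letter_act_count)
next
  case (snoc y w)
  have "letter_act y (word_act w (letter_act x g)) l = 0"
  proof (rule letter_act_count)
    fix l' assume "\<exists>q q'. l' = q @ fst y # q' \<and> l = q @ snd y # q'"
    then obtain q q' where "l' = q @ fst y # q'" "l = q @ snd y # q'" by blast
    then have "word_act (x # w) g l' = 0"
      using snoc.prems by (intro snoc.IH) (auto split: if_splits)
    then show "word_act w (letter_act x g) l' = 0" by simp
  qed
  then show ?case by (simp add: word_act_append)
qed

lemma irregular_act:
  assumes "irregular w" "\<forall>s\<in>set l. \<not> virtual s"
  shows "word_act w g l = 0"
proof -
  obtain k \<gamma> where k: "k < length w" and vg: "virtual \<gamma>"
    and *: "length (filter (\<lambda>x. snd x = \<gamma>) (take (Suc k) (rev w)))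
        > length (filter (\<lambda>x. fst x = \<gamma>) (take k (rev w)))"
    using assms(1) unfolding irregular_def by blast
  define w0 where "w0 = rev (take k (rev w))"
  define x where "x = rev w ! k"
  have tk: "take (Suc k) (rev w) = take k (rev w) @ [x]"
    using k by (simp add: take_Suc_conv_app_nth x_def)
  have "w = rev (take (Suc k) (rev w) @ drop (Suc k) (rev w))" by simp
  then have w: "w = rev (drop (Suc k) (rev w)) @ x # w0"
    unfolding rev_append tk by (simp add: w0_def)
  have "count_list l \<gamma> = 0" using assms(2) vg by (auto simp: count_list_0_iff)
  moreover have "length (filter (\<lambda>y. snd y = \<gamma>) (x # w0)) > length (filter (\<lambda>y. fst y = \<gamma>) w0)"
    using * unfolding tk by (simp add: w0_def rev_filter[symmetric] split: if_splits)
  \<comment> \<open>\<open>h\<close> is arbitrary because the factors to the left of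
    \<open>x\<close> only change the functional to which \<open>x # w0\<close> is applied.\<close>
  ultimately have "word_act (x # w0) h l = 0" for h
    by (intro irregular_suffix_act[where \<gamma>=\<gamma>]) simp
  then show ?thesis by (subst w) (simp only: word_act_append)
qed

lemma IrrS_act: "p \<in> IrrS n \<Longrightarrow> \<forall>s\<in>set l. \<not> virtual s \<Longrightarrow> fa_act p g l = 0"
  by (induction rule: IrrS.induct) (auto simp: UId_act irregular_act word_act_append)

text \<open>The normal ordered product of the (even) letters of \<open>M\<close>: the sum over all ways of letting
  them act at pairwise distinct tensor positions. It depends only on the multiset \<open>M\<close>, so it can be
  indexed by monomials.\<close>
fun normal_ord :: "letter multiset \<Rightarrow> (sym list \<Rightarrow> complex) \<Rightarrow> sym list \<Rightarrow> complex" where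
  "normal_ord M g [] = (if M = {#} then g [] else 0)"
| "normal_ord M g (s # l) = normal_ord M (\<lambda>l'. g (s # l')) l
     + (\<Sum>y\<in>#M. if snd y = s then normal_ord (M - {#y#}) (\<lambda>l'. g (fst y # l')) l else 0)"

section \<open>Calculus of normal ordered products\<close>

lemma normal_ord_zero [simp]: "normal_ord M (\<lambda>l. 0) l = 0"
  by (induction l arbitrary: M) (auto cong: if_cong)

lemma sum_mset_add: "(\<Sum>y\<in>#M. f y + g y) = (\<Sum>y\<in>#M. f y) + (\<Sum>y\<in>#M. (g y :: complex))"
  by (induction M) auto

lemma sum_mset_diff': "(\<Sum>y\<in>#M. f y - g y) = (\<Sum>y\<in>#M. f y) - (\<Sum>y\<in>#M. (g y :: complex))"
  by (induction M) auto

lemma sum_mset_cong: "(\<And>y. y \<in># M \<Longrightarrow> f y = g y) \<Longrightarrow> (\<Sum>y\<in>#M. f y) = (\<Sum>y\<in>#M. g y)"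
  by (metis image_mset_cong)

lemma sum_mset_remove1: "y \<in># M \<Longrightarrow> (\<Sum>z\<in>#M - {#y#}. f z) = (\<Sum>z\<in>#M. f z) - (f y :: complex)"
  by (metis (no_types, lifting) add_diff_cancel_left' image_mset_add_mset insert_DiffM sum_mset.insert)

text \<open>Adding the diagonal gives a full double sum, where the order of summation is free;
  afterwards the diagonal is taken away again.\<close>

lemma sum_mset_remove_swap:
  "(\<Sum>y\<in>#M. \<Sum>z\<in>#M - {#y#}. h y z) = (\<Sum>y\<in>#M. \<Sum>z\<in>#M - {#y#}. (h z y :: complex))"
proof -
  have "(\<Sum>y\<in>#M. \<Sum>z\<in>#M - {#y#}. h y z) = (\<Sum>y\<in>#M. (\<Sum>z\<in>#M. h y z) - h y y)"
    by (intro sum_mset_cong sum_mset_remove1)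
  also have "\<dots> = (\<Sum>y\<in>#M. \<Sum>z\<in>#M. h y z) - (\<Sum>y\<in>#M. h y y)"
    by (rule sum_mset_diff')
  also have "(\<Sum>y\<in>#M. \<Sum>z\<in>#M. h y z) = (\<Sum>y\<in>#M. \<Sum>z\<in>#M. h z y)"
    by (rule sum_mset.swap)
  also have "\<dots> - (\<Sum>y\<in>#M. h y y) = (\<Sum>y\<in>#M. (\<Sum>z\<in>#M. h z y) - h y y)"
    by (rule sum_mset_diff'[symmetric])
  also have "\<dots> = (\<Sum>y\<in>#M. \<Sum>z\<in>#M - {#y#}. h z y)"
    by (intro sum_mset_cong sum_mset_remove1[symmetric])
  finally show ?thesis .
qed

lemma normal_ord_add:
  "normal_ord M (\<lambda>l. g l + h l) l = normal_ord M g l + normal_ord M h l"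
proof (induction l arbitrary: M g h)
  case (Cons s l)
  have "(\<Sum>y\<in>#M. if snd y = s then normal_ord (M - {#y#}) (\<lambda>l'. g (fst y # l') + h (fst y # l')) l else 0)
    = (\<Sum>y\<in>#M. (if snd y = s then normal_ord (M - {#y#}) (\<lambda>l'. g (fst y # l')) l else 0)
       + (if snd y = s then normal_ord (M - {#y#}) (\<lambda>l'. h (fst y # l')) l else 0))"
    by (intro sum_mset_cong) (simp add: Cons.IH)
  then show ?case by (simp add: Cons.IH sum_mset_add)
qed simp

lemma normal_ord_if: "normal_ord M (\<lambda>l. if b then g l else 0) l = (if b then normal_ord M g l else 0)"
  by simp

text \<open>Wick's formula for one letter applied after the normal ordered product of
  \<open>M\<close>. Either \<open>x\<close> acts at a position that \<open>M\<close> leaves alone,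
  or it consumes the symbol that some \<open>y\<close> has just created there, and the two merge
  into one letter.\<close>

lemma normal_ord_letter_act:
  assumes x: "lpar x = 0"
  shows "normal_ord M (letter_act x g) l = normal_ord (add_mset x M) g l
    + (\<Sum>y\<in>#M. if fst y = snd x then normal_ord (add_mset (fst x, snd y) (M - {#y#})) g l else 0)"
proof (induction l arbitrary: M g)
  case Nil
  then show ?case by (simp add: if_distrib cong: if_cong)
next
  case (Cons s l)
  define F where "F y N = normal_ord N (\<lambda>l'. g (y # l')) l" for y N
  define c where "c y = (fst x, snd y)" for y :: letter
  have act: "normal_ord N (\<lambda>l'. letter_act x g (t # l')) l = (if t = snd x then F (fst x) N else 0)
      + (F t (add_mset x N) + (\<Sum>y\<in>#N. if fst y = snd x then F t (add_mset (c y) (N - {#y#})) else 0))" for t N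
    by (simp add: x normal_ord_add normal_ord_if Cons.IH F_def c_def cong: if_cong)
  have nord: "normal_ord N g (s # l) = F s N + (\<Sum>y\<in>#N. if snd y = s then F (fst y) (N - {#y#}) else 0)" for N
    by (simp add: F_def cong: if_cong)
  \<comment> \<open>The cases at the first position s, apart from those where only \<open>x\<close>
    acts there or nothing is contracted and s is skipped. \<open>?A\<close>: \<open>M\<close> skips
    s, and \<open>x\<close> is contracted in the tail. \<open>?B\<close>: a letter of
    \<open>M\<close> acts on s, and \<open>x\<close> acts alone in the tail. \<open>?C\<close>:
    \<open>x\<close> is contracted with the letter on s. \<open>?D\<close>: a letter acts on s, and
    \<open>x\<close> is contracted with another one in the tail.\<close>
  let ?A = "\<Sum>y\<in>#M. if fst y = snd x then F s (add_mset (c y) (M - {#y#})) else 0"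
  let ?B = "\<Sum>y\<in>#M. if snd y = s then F (fst y) (add_mset x (M - {#y#})) else 0"
  let ?C = "\<Sum>y\<in>#M. if snd y = s \<and> fst y = snd x then F (fst x) (M - {#y#}) else 0"
  let ?D = "\<Sum>y\<in>#M. \<Sum>z\<in>#M - {#y#}. 
      if snd y = s \<and> fst z = snd x then F (fst y) (add_mset (c z) (M - {#y#} - {#z#})) else 0"
  have "normal_ord M (letter_act x g) (s # l) = normal_ord M (\<lambda>l'. letter_act x g (s # l')) l
     + (\<Sum>y\<in>#M. if snd y = s then normal_ord (M - {#y#}) (\<lambda>l'. letter_act x g (fst y # l')) l else 0)"
    by (rule normal_ord.simps)
  also have "(\<Sum>y\<in>#M. if snd y = s then normal_ord (M - {#y#}) (\<lambda>l'. letter_act x g (fst y # l')) l else 0)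
    = (\<Sum>y\<in>#M. (if snd y = s \<and> fst y = snd x then F (fst x) (M - {#y#}) else 0)
        + (if snd y = s then F (fst y) (add_mset x (M - {#y#})) else 0)
        + (\<Sum>z\<in>#M - {#y#}. if snd y = s \<and> fst z = snd x then F (fst y) (add_mset (c z) (M - {#y#} - {#z#})) else 0))"
    unfolding act by (intro sum_mset_cong) auto
  also have "\<dots> = ?C + ?B + ?D"
    by (simp add: sum_mset_add)
  finally have L: "normal_ord M (letter_act x g) (s # l) = 
     (if s = snd x then F (fst x) M else 0) + (F s (add_mset x M) + ?A) + (?C + ?B + ?D)"
    unfolding act .
  have R1: "normal_ord (add_mset x M) g (s # l) = F s (add_mset x M) + ((if s = snd x then F (fst x) M else 0) + ?B)"
  proof -
    have "(\<Sum>y\<in>#M. if snd y = s then F (fst y) (add_mset x M - {#y#}) else 0) = ?B"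
      by (intro sum_mset_cong) simp
    then show ?thesis unfolding nord by (simp add: eq_commute[of s "snd x"])
  qed
  have c: "normal_ord (add_mset (c y) (M - {#y#})) g (s # l) = F s (add_mset (c y) (M - {#y#}))
     + ((if snd y = s then F (fst x) (M - {#y#}) else 0)
     + (\<Sum>z\<in>#M - {#y#}. if snd z = s then F (fst z) (add_mset (c y) (M - {#z#} - {#y#})) else 0))" for y
  proof -
    have "(\<Sum>z\<in>#M - {#y#}. if snd z = s then F (fst z) (add_mset (c y) (M - {#y#}) - {#z#}) else 0)
      = (\<Sum>z\<in>#M - {#y#}. if snd z = s then F (fst z) (add_mset (c y) (M - {#z#} - {#y#})) else 0)"
      by (intro sum_mset_cong) (simp add: add_mset_commute)
    then show ?thesis unfolding nord by (simp add: c_def)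
  qed
  have "(\<Sum>y\<in>#M. if fst y = snd x then normal_ord (add_mset (c y) (M - {#y#})) g (s # l) else 0)
     = (\<Sum>y\<in>#M. (if fst y = snd x then F s (add_mset (c y) (M - {#y#})) else 0)
        + (if snd y = s \<and> fst y = snd x then F (fst x) (M - {#y#}) else 0)
        + (\<Sum>z\<in>#M - {#y#}. if snd z = s \<and> fst y = snd x then F (fst z) (add_mset (c y) (M - {#z#} - {#y#})) else 0))"
    unfolding c by (intro sum_mset_cong) auto
  also have "\<dots> = ?A + ?C + (\<Sum>y\<in>#M. \<Sum>z\<in>#M - {#y#}. 
      if snd z = s \<and> fst y = snd x then F (fst z) (add_mset (c y) (M - {#z#} - {#y#})) else 0)"
    by (simp add: sum_mset_add)
  \<comment> \<open>Here the contracted letter is chosen first and the letter at s second;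
    \<open>?D\<close> chooses them the other way round.\<close>
  also have "(\<Sum>y\<in>#M. \<Sum>z\<in>#M - {#y#}. 
      if snd z = s \<and> fst y = snd x then F (fst z) (add_mset (c y) (M - {#z#} - {#y#})) else 0) = ?D"
    by (rule sum_mset_remove_swap)
  finally show ?case unfolding L R1 c_def by simp
qed

text \<open>Each letter of \<open>M\<close> needs a position carrying its second symbol. This
  removes the uncontracted term when e_{s,\<beta>} meets a tensor free of \<beta>.\<close>

lemma normal_ord_notin:
  "y \<in># M \<Longrightarrow> snd y \<notin> set l \<Longrightarrow> normal_ord M g l = 0"
proof (induction l arbitrary: M g)
  case (Cons s l)
  have "(\<Sum>z\<in>#M. if snd z = s then normal_ord (M - {#z#}) (\<lambda>l'. g (fst z # l')) l else 0) = (\<Sum>z\<in>#M. 0)"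
  proof (intro sum_mset_cong)
    fix z assume "z \<in># M"
    have "y \<in># M - {#z#}" if "snd z = s" 
      using Cons.prems that by (auto simp: in_diff_count)
    then show "(if snd z = s then normal_ord (M - {#z#}) (\<lambda>l'. g (fst z # l')) l else 0) = 0"
      using Cons by simp
  qed
  then show ?case using Cons by simp
qed auto

lemma normal_ord_size:
  "size M > length l \<Longrightarrow> normal_ord M g l = 0"
proof (induction l arbitrary: M g)
  case (Cons s l)
  have "(\<Sum>z\<in>#M. if snd z = s then normal_ord (M - {#z#}) (\<lambda>l'. g (fst z # l')) l else 0) = (\<Sum>z\<in>#M. 0)"
    using Cons.prems by (intro sum_mset_cong) (auto simp: size_Diff_singleton intro!: Cons.IH)
  then show ?case using Cons by simp
qed auto

text \<open>Every contraction term of Wick's formula vanishes. This applies to e_{D',T}, which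
  consumes proper symbols and creates virtual ones.\<close>

lemma word_act_noncontracting:
  assumes "\<forall>x\<in>set w. lpar x = 0" "\<forall>x\<in>set w. \<forall>y\<in>set w. fst y \<noteq> snd x"
  shows "word_act w g l = normal_ord (mset w) g l"
  using assms
proof (induction w arbitrary: g)
  case Nil
  have "normal_ord {#} g l = g l" by (induction l arbitrary: g) auto
  then show ?case by simp
next
  case (Cons x w)
  have "(\<Sum>y\<in>#mset w. if fst y = snd x then normal_ord (add_mset (fst x, snd y) (mset w - {#y#})) g l else 0) = (\<Sum>y\<in>#mset w. 0)"
    using Cons.prems by (intro sum_mset_cong) auto
  then show ?case using Cons by (simp add: normal_ord_letter_act)
qed

text \<open>The product of the factorials of the multiplicities: the number of permutations of the
  positions that leave the list unchanged.\<close>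

fun arrangements :: "'a list \<Rightarrow> nat" where
  "arrangements [] = 1"
| "arrangements (x # xs) = count (mset (x # xs)) x * arrangements xs"

lemma arrangements_pos: "arrangements xs > 0"
  by (induction xs) auto

lemma sum_mset_if_eq: "(\<Sum>z\<in>#M. if z = x then c else 0) = of_nat (count M x) * (c :: complex)"
  by (induction M) (auto simp: algebra_simps)

text \<open>With as many letters as positions, every position is hit once. Position i must turn
  \<open>snd (xs ! i)\<close> into \<open>fst (xs ! i)\<close>, which determines its letter, so only
  \<open>M = mset xs\<close> contributes, once for each permutation of equal letters.\<close>

lemma normal_ord_indicator:
  assumes "size M = length xs"
  shows "normal_ord M (\<lambda>l. if l = map fst xs then 1 else 0) (map snd xs)
    = (if M = mset xs then of_nat (arrangements xs) else 0)"
  using assms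
proof (induction xs arbitrary: M)
  case Nil
  then show ?case by simp
next
  case (Cons x xs)
  define c :: complex where "c = (if M - {#x#} = mset xs then of_nat (arrangements xs) else 0)"
  have "(\<Sum>z\<in>#M. if snd z = snd x then normal_ord (M - {#z#}) (\<lambda>l'. if fst z # l' = map fst (x # xs) then 1 else 0) (map snd xs) else 0)
    = (\<Sum>z\<in>#M. if z = x then c else 0)"
  proof (intro sum_mset_cong)
    fix z assume "z \<in># M"
    then have sz: "size (M - {#z#}) = length xs" using Cons.prems by (simp add: size_Diff_singleton)
    show "(if snd z = snd x then normal_ord (M - {#z#}) (\<lambda>l'. if fst z # l' = map fst (x # xs) then 1 else 0) (map snd xs) else 0)
       = (if z = x then c else 0)"
    proof (cases "z = x")
      case True
      then show ?thesis using Cons.IH[of "M - {#z#}"] sz by (simp add: c_def)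
    next
      case False
      then have "fst z \<noteq> fst x \<or> snd z \<noteq> snd x" by (simp add: prod_eq_iff)
      then show ?thesis using False by auto
    qed
  qed
  also have "\<dots> = of_nat (count M x) * c" by (rule sum_mset_if_eq)
  also have "\<dots> = (if M = mset (x # xs) then of_nat (arrangements (x # xs)) else 0)"
    by (cases "x \<in># M") (auto simp: c_def not_in_iff distrib_right dest: insert_DiffM)
  finally have S: "(\<Sum>z\<in>#M. if snd z = snd x then normal_ord (M - {#z#}) (\<lambda>l'. if fst z # l' = map fst (x # xs) then 1 else 0) (map snd xs) else 0)
    = (if M = mset (x # xs) then of_nat (arrangements (x # xs)) else 0)" .
  \<comment> \<open>Skipping the first position leaves too many letters for the tail.\<close>
  have z: "normal_ord M (\<lambda>l'. if snd x # l' = map fst (x # xs) then 1 else 0) (map snd xs) = 0"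
    using Cons.prems by (intro normal_ord_size) simp
  show ?case unfolding list.map(2)[of snd] normal_ord.simps z S by (rule add_0_left)
qed

section \<open>Faithfulness\<close>

definition gl :: "nat \<Rightarrow> letter set" where
  "gl n = Prop ` {1..n} \<times> Prop ` {1..n}"

lemma GLW_iff: "f \<in> GLW n \<longleftrightarrow> (\<forall>w\<in>supp f. set w \<subseteq> gl n)"
  unfolding GLW_def gl_def subset_iff mem_Times_iff mem_Collect_eq by blast

lemma supp_fw [simp]: "supp (fw w) = {w}"
  by (simp add: fw_def)

lemma fw_GLW: "set w \<subseteq> gl n \<Longrightarrow> fw w \<in> GLW n"
  by (simp add: GLW_iff)

lemma gl_lpar: "x \<in> gl n \<Longrightarrow> lpar x = 0"
  by (auto simp: gl_def lpar_def)

lemma gl_letters: "gl n \<subseteq> letters n"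
  by (auto simp: gl_def letters_def Syms_def)

text \<open>Stage \<open>k\<close> of a filtration of the operators by the number of letters. Each
  rule application adds one summand, so that \<open>lower_linext\<close> can collect the
  coefficients by induction.\<close>

inductive_set lower :: "nat \<Rightarrow> nat \<Rightarrow> ((sym list \<Rightarrow> complex) \<Rightarrow> sym list \<Rightarrow> complex) set" for n k where
  lower_zero: "(\<lambda>g l. 0) \<in> lower n k"
| lower_step: "\<lbrakk>size M < k; set_mset M \<subseteq> gl n; F \<in> lower n k\<rbrakk>
    \<Longrightarrow> (\<lambda>g l. c * normal_ord M g l + F g l) \<in> lower n k"

lemma lower_add: "F \<in> lower n k \<Longrightarrow> G \<in> lower n k \<Longrightarrow> (\<lambda>g l. F g l + G g l) \<in> lower n k"
proof (induction rule: lower.induct)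
  case (lower_step M F c)
  then show ?case using lower.lower_step[of M k n "\<lambda>g l. F g l + G g l" c] by (simp add: add.assoc)
qed simp

lemma lower_scale: "F \<in> lower n k \<Longrightarrow> (\<lambda>g l. c * F g l) \<in> lower n k"
proof (induction rule: lower.induct)
  case (lower_step M F d)
  then show ?case using lower.lower_step[of M k n "\<lambda>g l. c * F g l" "c * d"] by (simp add: algebra_simps)
qed (simp add: lower.lower_zero)

lemma lower_normal_ord: "size M < k \<Longrightarrow> set_mset M \<subseteq> gl n \<Longrightarrow> (\<lambda>g l. normal_ord M g l) \<in> lower n k"
  using lower.lower_step[OF _ _ lower.lower_zero, of M k n 1] by simp

lemma lower_sum_mset:
  "(\<And>y. y \<in># M \<Longrightarrow> (\<lambda>g l. f y g l) \<in> lower n k) \<Longrightarrow> (\<lambda>g l. \<Sum>y\<in>#M. f y g l) \<in> lower n k"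
proof (induction M)
  case (add x M)
  then show ?case using lower_add[of "f x" n k "\<lambda>g l. \<Sum>y\<in>#M. f y g l"] by simp
qed (simp add: lower.lower_zero)

lemma lower_mono: "F \<in> lower n k \<Longrightarrow> k \<le> k' \<Longrightarrow> F \<in> lower n k'"
  by (induction rule: lower.induct) (auto intro: lower.intros)

text \<open>A contraction merges two letters into one, so of the \<open>size M + 1\<close> letters
  in \<open>x\<close> and \<open>M\<close> one is lost.\<close>

lemma contraction_lower:
  assumes "x \<in> gl n" "set_mset M \<subseteq> gl n"
  shows "(\<lambda>g l. \<Sum>y\<in>#M. if fst y = snd x then normal_ord (add_mset (fst x, snd y) (M - {#y#})) g l else 0)
    \<in> lower n (Suc (size M))"
proof (rule lower_sum_mset)
  fix y assume y: "y \<in># M"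
  have "set_mset (add_mset (fst x, snd y) (M - {#y#})) \<subseteq> gl n"
    using assms y by (auto simp: gl_def dest: in_diffD)
  moreover have "size (add_mset (fst x, snd y) (M - {#y#})) < Suc (size M)"
    using size_Suc_Diff1[OF y] by simp
  ultimately show "(\<lambda>g l. if fst y = snd x then normal_ord (add_mset (fst x, snd y) (M - {#y#})) g l else 0)
    \<in> lower n (Suc (size M))"
    by (cases "fst y = snd x") (simp_all add: lower_normal_ord lower.lower_zero)
qed

lemma lower_letter_act:
  assumes x: "x \<in> gl n" and "F \<in> lower n k"
  shows "(\<lambda>g l. F (letter_act x g) l) \<in> lower n (Suc k)"
  using assms(2)
proof (induction rule: lower.induct)
  case (lower_step M F c)
  let ?C = "\<lambda>g l. \<Sum>y\<in>#M. if fst y = snd x then normal_ord (add_mset (fst x, snd y) (M - {#y#})) g l else 0"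
  have "?C \<in> lower n (Suc k)"
    using contraction_lower[OF x lower_step(2)] lower_step(1) by (auto intro: lower_mono)
  then have "(\<lambda>g l. c * ?C g l + F (letter_act x g) l) \<in> lower n (Suc k)"
    by (intro lower_add lower_scale lower_step)
  then have "(\<lambda>g l. c * normal_ord (add_mset x M) g l + (c * ?C g l + F (letter_act x g) l)) \<in> lower n (Suc k)"
    using lower_step x by (intro lower.lower_step) auto
  then show ?case
    by (simp add: normal_ord_letter_act gl_lpar[OF x] algebra_simps)
qed (rule lower.lower_zero)

text \<open>Wick's formula, letter by letter. The leading term forgets the order of the letters,
  which makes the passage from words to normal ordered products triangular.\<close>

lemma word_act_expansion:
  "set w \<subseteq> gl n \<Longrightarrow> (\<lambda>g l. word_act w g l - normal_ord (mset w) g l) \<in> lower n (length w)"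
proof (induction w)
  case Nil
  have "word_act [] g l = normal_ord (mset []) g l" for g l
    by (rule word_act_noncontracting) auto
  then show ?case by (simp add: lower.lower_zero)
next
  case (Cons x w)
  then have x: "x \<in> gl n" by simp
  have "(\<lambda>g l. word_act w (letter_act x g) l - normal_ord (mset w) (letter_act x g) l) \<in> lower n (Suc (length w))"
    using Cons by (intro lower_letter_act[where F = "\<lambda>g l. word_act w g l - normal_ord (mset w) g l"]) auto
  moreover have "(\<lambda>g l. \<Sum>y\<in>#mset w. if fst y = snd x then normal_ord (add_mset (fst x, snd y) (mset w - {#y#})) g l else 0)
    \<in> lower n (Suc (length w))"
    using contraction_lower[OF x, of "mset w"] Cons.prems by simp
  ultimately have "(\<lambda>g l. (word_act w (letter_act x g) l - normal_ord (mset w) (letter_act x g) l) +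
     (\<Sum>y\<in>#mset w. if fst y = snd x then normal_ord (add_mset (fst x, snd y) (mset w - {#y#})) g l else 0))
     \<in> lower n (Suc (length w))"
    by (rule lower_add)
  then show ?case
    by (simp add: normal_ord_letter_act gl_lpar[OF x] algebra_simps)
qed

lemma lower_linext:
  "F \<in> lower n k \<Longrightarrow> \<exists>a. (\<forall>g l. F g l = linext (\<lambda>M. normal_ord M g l) a) \<and>
     (\<forall>M\<in>supp a. size M < k \<and> set_mset M \<subseteq> gl n)"
proof (induction rule: lower.induct)
  case lower_zero
  show ?case by (rule exI[of _ 0]) simp
next
  case (lower_step M F c)
  then obtain a where a: "\<forall>g l. F g l = linext (\<lambda>M. normal_ord M g l) a"
     "\<forall>M\<in>supp a. size M < k \<and> set_mset M \<subseteq> gl n" by blast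
  have "supp (sngl M c + a) \<subseteq> insert M (supp a)"
    using Poly_Mapping.keys_add[of "sngl M c" a] by (auto split: if_splits)
  then have "\<forall>M\<in>supp (sngl M c + a). size M < k \<and> set_mset M \<subseteq> gl n"
    using a(2) lower_step(1,2) by blast
  then show ?case using a(1)
    by (intro exI[of _ "sngl M c + a"]) simp
qed

text \<open>A product of minimal size \<open>d\<close>, applied to tensors of length \<open>d\<close>, has to fill every position, while
  longer products vanish there.\<close>
lemma normal_ord_independent:
  assumes zero: "\<And>g l. set l \<subseteq> range Prop \<Longrightarrow> linext (\<lambda>M. normal_ord M g l) A = 0"
    and gl: "\<forall>M\<in>supp A. set_mset M \<subseteq> gl n"
  shows "A = 0"
proof (rule ccontr)
  assume "A \<noteq> 0"
  then obtain M0 where "M0 \<in> supp A" by (metis all_not_in_conv keys_eq_empty)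
  then obtain M where M: "M \<in> supp A" "\<And>M'. M' \<in> supp A \<Longrightarrow> size M \<le> size M'"
    using ex_has_least_nat[of "\<lambda>M. M \<in> supp A" M0 size] by blast
  obtain xs where xs: "mset xs = M" using ex_mset by blast
  \<comment> \<open>\<open>map snd xs\<close> offers each letter of \<open>M\<close> exactly the
    position that it needs, and \<open>?g\<close> detects the tensor in which all of them have
    acted.\<close>
  let ?g = "\<lambda>l. if l = map fst xs then 1 else (0::complex)"
  have "set xs \<subseteq> gl n" using bspec[OF gl M(1)] unfolding xs[symmetric] set_mset_mset .
  then have "0 = linext (\<lambda>M. normal_ord M ?g (map snd xs)) A"
    by (intro zero[symmetric]) (auto simp: gl_def)
  also have "\<dots> = linext (\<lambda>M'. if M' = M then of_nat (arrangements xs) else 0) A"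
  proof (rule linext_cong)
    fix M' assume "M' \<in> supp A"
    then have "size M' \<ge> length xs" using M(2) xs by force
    then consider "size M' > length xs" | "size M' = length xs" by linarith
    then show "normal_ord M' ?g (map snd xs) = (if M' = M then of_nat (arrangements xs) else 0)"
    proof cases
      case 1
      then show ?thesis using xs by (auto simp: normal_ord_size)
    next
      case 2
      show ?thesis unfolding normal_ord_indicator[OF 2] xs ..
    qed
  qed
  also have "\<dots> = coef A M * of_nat (arrangements xs)"
    using M(1) by (simp add: linext_def if_distrib cong: if_cong)
  finally show False using M(1) arrangements_pos[of xs] by (auto simp: in_keys_iff)
qed

section \<open>The filtration of U(gl(n)) by word length\<close>

lemma fmul_fw_in_UId:
  assumes "p \<in> UId n" "x \<in> letters n"
  shows "fmul (fw [x]) p \<in> UId n"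
  using assms(1)
proof (induction rule: UId.induct)
  case (UId_gen u v y z)
  have "fmul (fw [x]) (urel_in u y z v) = urel_in (x # u) y z v"
    by (simp add: urel_in_def Let_def fmul_diff_right fmul_fsc_right)
  then show ?case using UId_gen assms(2) urel_in_UId[of "x # u" n v y z]
    by (simp add: fmul_urel words_def)
qed (auto simp: fmul_add_right fmul_fsc_right intro: UId.intros)

lemma supp_fmul_fw: "supp (fmul (fw [x]) r) \<subseteq> (#) x ` supp r"
proof -
  have "fmul (fw [x]) r = (\<Sum>v\<in>supp r. sngl (x # v) (coef r v))"
    by (subst fmul_superset[of "{[x]}" _ "supp r"]) (auto simp: fw_def)
  also have "supp \<dots> \<subseteq> (\<Union>v\<in>supp r. supp (sngl (x # v) (coef r v)))"
    by (rule Poly_Mapping.keys_sum)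
  also have "\<dots> \<subseteq> (#) x ` supp r" by (auto split: if_splits)
  finally show ?thesis .
qed

text \<open>Equality in the graded algebra associated with the filtration by word length.\<close>

definition sort_rel :: "nat \<Rightarrow> letter list \<Rightarrow> letter list \<Rightarrow> bool" where
  "sort_rel n w w' \<longleftrightarrow> (\<exists>r\<in>GLW n. (\<forall>v\<in>supp r. length v < length w) \<and> fw w - fw w' - r \<in> UId n)"

lemma sort_rel_refl: "sort_rel n w w"
  unfolding sort_rel_def by (rule bexI[of _ 0]) (auto intro: UId_zero)

lemma sort_rel_trans:
  assumes "sort_rel n u v" "sort_rel n v w" "length u = length v"
  shows "sort_rel n u w"
proof -
  obtain r s where r: "r \<in> GLW n" "\<forall>v\<in>supp r. length v < length u" "fw u - fw v - r \<in> UId n"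
    and s: "s \<in> GLW n" "\<forall>w\<in>supp s. length w < length u" "fw v - fw w - s \<in> UId n"
    using assms unfolding sort_rel_def by auto
  have "fw u - fw w - (r + s) \<in> UId n"
    using UId_add[OF r(3) s(3)] by (simp add: algebra_simps)
  moreover have "\<forall>x\<in>supp (r + s). length x < length u"
    using Poly_Mapping.keys_add[of r s] r(2) s(2) by blast
  ultimately show ?thesis unfolding sort_rel_def using GLW_add[OF r(1) s(1)] by blast
qed

lemma sort_rel_Cons:
  assumes "sort_rel n u v" "x \<in> gl n"
  shows "sort_rel n (x # u) (x # v)"
proof -
  obtain r where r: "r \<in> GLW n" "\<forall>v\<in>supp r. length v < length u" "fw u - fw v - r \<in> UId n"
    using assms unfolding sort_rel_def by auto
  have "fw (x # u) - fw (x # v) - fmul (fw [x]) r \<in> UId n"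
    using fmul_fw_in_UId[OF r(3), of x] assms(2) gl_letters by (auto simp: fmul_diff_right)
  moreover have "fmul (fw [x]) r \<in> GLW n"
    unfolding GLW_iff
  proof
    fix w assume "w \<in> supp (fmul (fw [x]) r)"
    then obtain v where "v \<in> supp r" "w = x # v" using supp_fmul_fw by blast
    then show "set w \<subseteq> gl n" using r(1) assms(2) by (simp add: GLW_iff)
  qed
  moreover have "\<forall>v\<in>supp (fmul (fw [x]) r). length v < length (x # u)"
    using r(2) by (auto dest!: subsetD[OF supp_fmul_fw])
  ultimately show ?thesis unfolding sort_rel_def by blast
qed

lemma sort_rel_swap:
  assumes "x \<in> gl n" "y \<in> gl n" "set v \<subseteq> gl n"
  shows "sort_rel n (x # y # v) (y # x # v)"
proof -
  let ?r = "(if snd x = fst y then fw ((fst x, snd y) # v) else 0)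
        - (if fst x = snd y then fw ((fst y, snd x) # v) else 0)"
  have "urel_in [] x y v \<in> UId n"
    using assms gl_letters[of n] by (intro urel_in_UId) (auto simp: words_def)
  also have "urel_in [] x y v = fw (x # y # v) - fw (y # x # v) - ?r"
    by (simp add: urel_in_def gl_lpar[OF assms(1)])
  finally have "fw (x # y # v) - fw (y # x # v) - ?r \<in> UId n" .
  moreover have "?r \<in> GLW n"
    using assms by (intro GLW_diff) (auto intro!: fw_GLW simp: gl_def)
  moreover have "\<forall>w\<in>supp ?r. length w < length (x # y # v)"
    by (auto dest!: subsetD[OF Poly_Mapping.keys_diff] split: if_splits)
  ultimately show ?thesis unfolding sort_rel_def by blast
qed

lemma sort_rel_move:
  "x \<in> gl n \<Longrightarrow> set a \<subseteq> gl n \<Longrightarrow> set b \<subseteq> gl n \<Longrightarrow> sort_rel n (x # a @ b) (a @ x # b)"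
proof (induction a)
  case (Cons y a)
  have "sort_rel n (x # y # a @ b) (y # x # a @ b)" using Cons by (intro sort_rel_swap) auto
  moreover have "sort_rel n (y # x # a @ b) (y # a @ x # b)" using Cons by (intro sort_rel_Cons) auto
  ultimately show ?case using sort_rel_trans[of n "x # y # a @ b" "y # x # a @ b"] by simp
qed (simp add: sort_rel_refl)

text \<open>The associated graded algebra is commutative. The rest of \<open>w\<close> is rearranged
  by induction, and its first letter is then moved to its place in \<open>w'\<close>.\<close>

lemma sort_rel_mset:
  "set w \<subseteq> gl n \<Longrightarrow> mset w = mset w' \<Longrightarrow> sort_rel n w w'"
proof (induction w arbitrary: w')
  case Nil
  then show ?case by (simp add: sort_rel_refl)
next
  case (Cons x w)
  then have "x \<in> set w'" by (metis list.set_intros(1) mset_eq_setD)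
  then obtain a b where w': "w' = a @ x # b" by (meson split_list)
  have m: "mset w = mset (a @ b)" using Cons.prems w' by simp
  have gl: "set a \<subseteq> gl n" "set b \<subseteq> gl n" "x \<in> gl n" using Cons.prems mset_eq_setD[OF m] by auto
  have "sort_rel n (x # w) (x # a @ b)" using Cons m by (intro sort_rel_Cons Cons.IH) auto
  moreover have "sort_rel n (x # a @ b) w'" unfolding w' by (intro sort_rel_move gl)
  moreover have "length (x # w) = length (x # a @ b)" using mset_eq_length[OF m] by simp
  ultimately show ?case by (rule sort_rel_trans)
qed

lemma fsc_sum_left: "(\<Sum>i\<in>A. fsc (c i) f) = fsc (sum c A) f"
  by (induction A rule: infinite_finite_induct) (auto simp: fsc_add_left)

text \<open>No word of \<open>u\<close> is longer than \<open>size M\<close>, and corrections are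
  shorter than their word. So the normal ordered product of \<open>M\<close> arises only as a
  leading term, and independence forces its total coefficient to be zero.\<close>

lemma top_coefficients_vanish:
  assumes u: "u \<in> GLW n" and len: "\<forall>w\<in>supp u. length w \<le> size M"
    and zero: "\<And>g l. set l \<subseteq> range Prop \<Longrightarrow> fa_act u g l = 0"
  shows "(\<Sum>w | w \<in> supp u \<and> mset w = M. coef u w) = 0"
proof -
  have "\<exists>a. (\<forall>g l. word_act w g l - normal_ord (mset w) g l = linext (\<lambda>M. normal_ord M g l) a) \<and>
     (\<forall>M\<in>supp a. size M < length w \<and> set_mset M \<subseteq> gl n)" if "w \<in> supp u" for w
    by (rule lower_linext[OF word_act_expansion]) (use u that in \<open>simp add: GLW_iff\<close>)
  then have "\<exists>a. \<forall>w\<in>supp u. (\<forall>g l. word_act w g l - normal_ord (mset w) g l = linext (\<lambda>M. normal_ord M g l) (a w)) \<and>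
     (\<forall>M\<in>supp (a w). size M < length w \<and> set_mset M \<subseteq> gl n)"
    by (intro bchoice ballI)
  then obtain a where a: "\<And>w g l. w \<in> supp u \<Longrightarrow> word_act w g l - normal_ord (mset w) g l = linext (\<lambda>M. normal_ord M g l) (a w)"
     and a': "\<And>w M. w \<in> supp u \<Longrightarrow> M \<in> supp (a w) \<Longrightarrow> size M < length w \<and> set_mset M \<subseteq> gl n"
    by blast
  \<comment> \<open>The coefficients of the whole action of \<open>u\<close> on normal ordered
    products: for each word its leading multiset and its corrections.\<close>
  define A where "A = (\<Sum>w\<in>supp u. Poly_Mapping.map (\<lambda>c. coef u w * c) (sngl (mset w) 1 + a w))"
  have coefA: "coef A M = (\<Sum>w\<in>supp u. coef u w * ((if mset w = M then 1 else 0) + coef (a w) M))" for M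
    by (simp add: A_def lookup_sum coef_scale lookup_add lookup_single when_def)
  have "linext (\<lambda>M. normal_ord M g l) A = fa_act u g l" for g l
  proof -
    have "linext (\<lambda>M. normal_ord M g l) A = (\<Sum>w\<in>supp u. coef u w * (normal_ord (mset w) g l + linext (\<lambda>M. normal_ord M g l) (a w)))"
      by (simp add: A_def)
    also have "\<dots> = (\<Sum>w\<in>supp u. coef u w * word_act w g l)"
    proof (intro sum.cong refl)
      fix w assume "w \<in> supp u"
      then show "coef u w * (normal_ord (mset w) g l + linext (\<lambda>M. normal_ord M g l) (a w)) = coef u w * word_act w g l"
        by (subst a[symmetric]) simp_all
    qed
    finally show ?thesis by (simp add: fa_act_def linext_def)
  qed
  then have "A = 0"
  proof (intro normal_ord_independent[of A n] ballI)
    fix M' assume "M' \<in> supp A"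
    then have "(\<Sum>w\<in>supp u. coef u w * ((if mset w = M' then 1 else 0) + coef (a w) M')) \<noteq> 0"
      unfolding in_keys_iff coefA .
    then obtain w where w: "w \<in> supp u" "coef u w * ((if mset w = M' then 1 else 0) + coef (a w) M') \<noteq> 0"
      by (rule sum.not_neutral_contains_not_neutral)
    show "set_mset M' \<subseteq> gl n"
    proof (cases "mset w = M'")
      case True
      then show ?thesis using u w(1) by (simp add: GLW_iff True[symmetric])
    next
      case False
      then have "M' \<in> supp (a w)" using w(2) by (simp add: in_keys_iff)
      then show ?thesis using a'[OF w(1)] by blast
    qed
  qed (simp add: zero)
  moreover have "coef (a w) M = 0" if "w \<in> supp u" for w
    using a'[OF that, of M] bspec[OF len that] unfolding in_keys_iff by linarith
  then have "coef A M = (\<Sum>w\<in>supp u. if mset w = M then coef u w else 0)"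
    unfolding coefA by (intro sum.cong refl) auto
  ultimately show ?thesis by (simp add: sum.inter_filter[symmetric])
qed

text \<open>Descent on a strict bound \<open>d\<close> for the word lengths. Words of top length
  with the same letters are traded for one common representative, whose total coefficient vanishes
  by \<open>top_coefficients_vanish\<close>; only shorter words survive.\<close>

theorem GLW_act_faithful:
  assumes "u \<in> GLW n" "\<And>g l. set l \<subseteq> range Prop \<Longrightarrow> fa_act u g l = 0"
  shows "u \<in> UId n"
proof -
  have "\<forall>w\<in>supp u. length w < d \<Longrightarrow> u \<in> UId n" for d
    using assms
  proof (induction d arbitrary: u)
    case 0
    then have "supp u = {}" by auto
    then have "u = 0" by (simp only: keys_eq_empty)
    then show ?case by (simp add: UId_zero)
  next
    case (Suc d)
    define S where "S = {w \<in> supp u. length w = d}"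
    define rep where "rep M = (SOME w :: letter list. mset w = M)" for M
    have rep: "mset (rep M) = M" for M
      unfolding rep_def by (rule someI_ex) (rule ex_mset)
    have "\<exists>r. r \<in> GLW n \<and> (\<forall>v\<in>supp r. length v < length w) \<and> fw w - fw (rep (mset w)) - r \<in> UId n" if "w \<in> S" for w
    proof -
      have "set w \<subseteq> gl n" using Suc.prems(2) that by (simp add: S_def GLW_iff)
      then have "sort_rel n w (rep (mset w))" by (rule sort_rel_mset) (simp add: rep)
      then show ?thesis unfolding sort_rel_def by blast
    qed
    then have "\<exists>r. \<forall>w\<in>S. r w \<in> GLW n \<and> (\<forall>v\<in>supp (r w). length v < length w) \<and> fw w - fw (rep (mset w)) - r w \<in> UId n"
      by (intro bchoice ballI)
    then obtain r where r: "\<And>w. w \<in> S \<Longrightarrow> r w \<in> GLW n"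
      "\<And>w v. w \<in> S \<Longrightarrow> v \<in> supp (r w) \<Longrightarrow> length v < length w"
      "\<And>w. w \<in> S \<Longrightarrow> fw w - fw (rep (mset w)) - r w \<in> UId n" by blast
    \<comment> \<open>What survives of \<open>u\<close>: the remainders from trading the top words,
      and the words that were shorter from the start.\<close>
    define u' where "u' = (\<Sum>w\<in>S. fsc (coef u w) (r w)) + (\<Sum>w\<in>supp u - S. fsc (coef u w) (fw w))"
    have "(\<Sum>w\<in>S. fsc (coef u w) (fw (rep (mset w)))) =
       (\<Sum>M\<in>mset ` S. \<Sum>w | w \<in> S \<and> mset w = M. fsc (coef u w) (fw (rep (mset w))))"
      by (rule sum.image_gen) (simp add: S_def)
    also have "\<dots> = 0"
    proof (rule sum.neutral, rule ballI)
      fix M assume "M \<in> mset ` S"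
      then have M: "size M = d" by (auto simp: S_def)
      have "(\<Sum>w | w \<in> S \<and> mset w = M. fsc (coef u w) (fw (rep (mset w)))) = fsc (\<Sum>w | w \<in> S \<and> mset w = M. coef u w) (fw (rep M))"
        by (simp add: fsc_sum_left[symmetric])
      moreover have "{w. w \<in> S \<and> mset w = M} = {w. w \<in> supp u \<and> mset w = M}"
        using M by (auto simp: S_def)
      moreover have "(\<Sum>w | w \<in> supp u \<and> mset w = M. coef u w) = 0"
        using Suc.prems M by (intro top_coefficients_vanish[of u n]) (auto simp: less_Suc_eq_le)
      ultimately show "(\<Sum>w | w \<in> S \<and> mset w = M. fsc (coef u w) (fw (rep (mset w)))) = 0" by simp
    qed
    finally have X: "(\<Sum>w\<in>S. fsc (coef u w) (fw (rep (mset w)))) = 0" .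
    have "u = (\<Sum>w\<in>supp u. fsc (coef u w) (fw w))" using sum_monomials[of u] by (simp add: fw_def)
    also have "\<dots> = (\<Sum>w\<in>S. fsc (coef u w) (fw w)) + (\<Sum>w\<in>supp u - S. fsc (coef u w) (fw w))"
      by (subst sum.subset_diff[of S "supp u"]) (auto simp: S_def add.commute)
    finally have "u - u' = (\<Sum>w\<in>S. fsc (coef u w) (fw w)) - (\<Sum>w\<in>S. fsc (coef u w) (fw (rep (mset w)))) - (\<Sum>w\<in>S. fsc (coef u w) (r w))"
      unfolding X u'_def by (simp add: algebra_simps)
    also have "\<dots> = (\<Sum>w\<in>S. fsc (coef u w) (fw w - fw (rep (mset w)) - r w))"
      by (simp add: sum_subtractf fsc_diff)
    finally have diff: "u - u' \<in> UId n" using r(3) by (auto intro!: UId_sum UId_smult)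
    have "u' \<in> UId n"
    proof (rule Suc.IH)
      have "length v < d" if "v \<in> supp u'" for v
      proof -
        have "coef u' v \<noteq> 0" using that by (simp add: in_keys_iff)
        then have "(\<Sum>w\<in>S. coef u w * coef (r w) v) \<noteq> 0 \<or> (\<Sum>w\<in>supp u - S. coef u w * coef (fw w) v) \<noteq> 0"
          by (auto simp: u'_def lookup_add lookup_sum)
        then consider "(\<Sum>w\<in>S. coef u w * coef (r w) v) \<noteq> 0" | "(\<Sum>w\<in>supp u - S. coef u w * coef (fw w) v) \<noteq> 0"
          by blast
        then show ?thesis
        proof cases
          case 1
          then obtain w where w: "w \<in> S" "coef u w * coef (r w) v \<noteq> 0"
            by (rule sum.not_neutral_contains_not_neutral)
          then have "length v < length w" by (intro r(2)) (auto simp: in_keys_iff)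
          then show ?thesis using w(1) by (simp add: S_def)
        next
          case 2
          then obtain w where w: "w \<in> supp u - S" "coef u w * coef (fw w) v \<noteq> 0"
            by (rule sum.not_neutral_contains_not_neutral)
          then have "w = v" by (auto simp: fw_def lookup_single when_def split: if_splits)
          then show ?thesis using w(1) Suc.prems(1) by (auto simp: S_def less_Suc_eq)
        qed
      qed
      then show "\<forall>w\<in>supp u'. length w < d" by blast
      show "u' \<in> GLW n"
        unfolding u'_def using Suc.prems(2)
        by (auto intro!: GLW_add GLW_sum GLW_smult r(1) fw_GLW simp: GLW_iff[of u])
      fix g l assume "set l \<subseteq> range Prop"
      then have "fa_act u g l = 0" by (rule Suc.prems(3))
      then show "fa_act u' g l = 0" using UId_act[OF diff, of g l] by simp
    qed
    then show ?case using UId_add[OF diff, of u'] by simp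
  qed
  moreover have "\<forall>w\<in>supp u. length w < Suc (\<Sum>w\<in>supp u. length w)"
    by (auto simp: less_Suc_eq_le intro: member_le_sum)
  ultimately show ?thesis by blast
qed

section \<open>Existence of the projection\<close>

text \<open>The letters from which Capelli words are built. Without \<open>Alpha\<close> symbols
  they are all even, and their brackets involve no others, so reordering produces no sign.\<close>

definition beta_prop :: "nat \<Rightarrow> letter set" where
  "beta_prop n = (range Beta \<union> Prop ` {1..n}) \<times> (range Beta \<union> Prop ` {1..n})"

text \<open>The virtual degree. Modulo \<open>Irr\<close>, a word without positive virtual symbols reduces to words
  \<open>e\<^bsub>\<beta>,j\<^esub> \<dots> e\<^bsub>\<beta>',j'\<^esub> u\<close> with \<open>u\<close> in \<open>U(gl(n))\<close>, and their number of leading factors is its virtual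
  degree.\<close>
definition vdeg :: "letter \<Rightarrow> int" where
  "vdeg x = (if virtual (fst x) then 1 else 0) - (if virtual (snd x) then 1 else 0)"

lemma beta_prop_letters: "beta_prop n \<subseteq> letters n"
  by (auto simp: beta_prop_def letters_def Syms_def)

lemma beta_prop_lpar: "x \<in> beta_prop n \<Longrightarrow> lpar x = 0"
  by (auto simp: beta_prop_def lpar_def)

text \<open>The degree is an integer since a word may consume more virtual symbols than it creates.
  For negative \<open>k\<close> no normal word exists and only Irr is left.\<close>

inductive_set normal_span :: "nat \<Rightarrow> int \<Rightarrow> fa set" for n k where
  normal_span_Irr: "p \<in> IrrS n \<Longrightarrow> p \<in> normal_span n k"
| normal_span_word: "set p \<subseteq> range Beta \<times> Prop ` {1..n} \<Longrightarrow> set q \<subseteq> gl n \<Longrightarrow> k = int (length p)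
    \<Longrightarrow> fw (p @ q) \<in> normal_span n k"
| normal_span_add: "f \<in> normal_span n k \<Longrightarrow> g \<in> normal_span n k \<Longrightarrow> f + g \<in> normal_span n k"
| normal_span_smult: "f \<in> normal_span n k \<Longrightarrow> fsc c f \<in> normal_span n k"

lemma normal_span_diff: "f \<in> normal_span n k \<Longrightarrow> g \<in> normal_span n k \<Longrightarrow> f - g \<in> normal_span n k"
  using normal_span_add[OF _ normal_span_smult[of g n k "-1"], of f] by (simp add: fsc_minus_one)

lemma normal_span_zero: "0 \<in> normal_span n k"
  by (intro normal_span_Irr IrrS_UId UId_zero)

lemma fmul_fw_in_IrrS:
  assumes "p \<in> IrrS n" "x \<in> letters n"
  shows "fmul (fw [x]) p \<in> IrrS n"
  using assms(1)
proof (induction rule: IrrS.induct)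
  case (IrrS_gen u w)
  then show ?case using assms(2) IrrS.IrrS_gen[of "x # u" n w] by (simp add: words_def)
qed (auto simp: fmul_add_right fmul_fsc_right intro: IrrS.intros fmul_fw_in_UId assms(2))

lemma normal_span_raise:
  assumes "f \<in> normal_span n k" "x \<in> range Beta \<times> Prop ` {1..n}"
  shows "fmul (fw [x]) f \<in> normal_span n (k + 1)"
  using assms(1)
proof (induction rule: normal_span.induct)
  case (normal_span_Irr p)
  have "x \<in> letters n" using assms(2) by (auto simp: letters_def Syms_def)
  with normal_span_Irr show ?case by (intro normal_span.normal_span_Irr fmul_fw_in_IrrS)
next
  case (normal_span_word p q)
  then show ?case using assms(2) normal_span.normal_span_word[of "x # p" n q "k + 1"] by simp
qed (auto simp: fmul_add_right fmul_fsc_right intro: normal_span.intros)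

text \<open>At \<open>k = length q\<close> at least one copy of \<open>snd x\<close> is demanded,
  while the factors of \<open>q\<close> create only proper symbols.\<close>

lemma irregular_annihilator:
  assumes "virtual (snd x)" "set q \<subseteq> gl n"
  shows "irregular (x # q)"
proof -
  have "filter (\<lambda>y. fst y = snd x) (rev q) = []" 
    using assms by (fastforce simp: filter_empty_conv gl_def)
  then show ?thesis
    using assms unfolding irregular_def
    by (intro exI[of _ "length q"] conjI exI[of _ "snd x"]) auto
qed

text \<open>\<open>x\<close> is commuted to the right through \<open>p\<close>. The bracket terms
  are again one letter in front of a shorter \<open>p\<close>, of the same total degree, which is
  why \<open>x\<close> is arbitrary in the induction. On reaching \<open>q\<close> the letter makes
  the word irregular, creates a virtual symbol, or joins \<open>q\<close>, depending on which of its
  symbols are virtual.\<close>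

lemma normal_span_letter_word:
  assumes "x \<in> beta_prop n" "set p \<subseteq> range Beta \<times> Prop ` {1..n}" "set q \<subseteq> gl n"
    and "k = int (length p) + vdeg x"
  shows "fw (x # p @ q) \<in> normal_span n k"
  using assms
proof (induction p arbitrary: x k)
  case Nil
  show ?case
  proof (cases "virtual (snd x)")
    case True
    have "x # q \<in> words n" 
      using Nil beta_prop_letters[of n] gl_letters[of n] by (auto simp: words_def)
    then have "fw ([] @ x # q) \<in> IrrS n"
      by (intro IrrS_gen irregular_annihilator[OF True Nil(3)]) (auto simp: words_def)
    then show ?thesis by (auto intro: normal_span_Irr)
  next
    case snd: False
    show ?thesis
    proof (cases "virtual (fst x)")
      case True
      then show ?thesis using snd Nil normal_span_word[of "[x]" n q k]
        by (auto simp: beta_prop_def vdeg_def)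
    next
      case False
      then show ?thesis using snd Nil normal_span_word[of "[]" n "x # q" k]
        by (auto simp: beta_prop_def vdeg_def gl_def)
    qed
  qed
next
  case (Cons y p)
  then have y: "y \<in> range Beta \<times> Prop ` {1..n}" and p: "set p \<subseteq> range Beta \<times> Prop ` {1..n}" by auto
  have y': "y \<in> beta_prop n" using y by (auto simp: beta_prop_def)
  have "x # y # p @ q \<in> words n" 
    using Cons.prems y' beta_prop_letters[of n] gl_letters[of n] by (auto simp: words_def letters_def Syms_def)
  then have "urel_in [] x y (p @ q) \<in> UId n"
    by (intro urel_in_UId) (auto simp: words_def)
  then have U: "urel_in [] x y (p @ q) \<in> normal_span n k"
    by (intro normal_span_Irr IrrS_UId)
  have A: "fw (y # x # p @ q) \<in> normal_span n k"
    using normal_span_raise[OF Cons.IH[OF Cons.prems(1) p Cons.prems(3) refl] y] Cons.prems(4)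
    by (simp add: add_ac)
  have B: "(if snd x = fst y then fw ((fst x, snd y) # p @ q) else 0) \<in> normal_span n k"
  proof (cases "snd x = fst y")
    case True
    have "fw ((fst x, snd y) # p @ q) \<in> normal_span n k"
      using Cons.prems y True by (intro Cons.IH) (auto simp: beta_prop_def vdeg_def)
    then show ?thesis using True by simp
  qed (simp add: normal_span_zero)
  have C: "(if fst x = snd y then fw ((fst y, snd x) # p @ q) else 0) \<in> normal_span n k"
  proof (cases "fst x = snd y")
    case True
    have "fw ((fst y, snd x) # p @ q) \<in> normal_span n k"
      using Cons.prems y True by (intro Cons.IH) (auto simp: beta_prop_def vdeg_def)
    then show ?thesis using True by simp
  qed (simp add: normal_span_zero)
  have "fw (x # (y # p) @ q) = urel_in [] x y (p @ q) + fw (y # x # p @ q)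
    + ((if snd x = fst y then fw ((fst x, snd y) # p @ q) else 0) 
      - (if fst x = snd y then fw ((fst y, snd x) # p @ q) else 0))"
    by (simp add: urel_in_def beta_prop_lpar[OF Cons.prems(1)])
  also have "\<dots> \<in> normal_span n k"
    by (intro normal_span_add normal_span_diff U A B C)
  finally show ?case .
qed

lemma normal_span_letter:
  assumes "f \<in> normal_span n k" "x \<in> beta_prop n"
  shows "fmul (fw [x]) f \<in> normal_span n (k + vdeg x)"
  using assms(1)
proof (induction rule: normal_span.induct)
  case (normal_span_Irr p)
  then show ?case using assms(2) beta_prop_letters
    by (intro normal_span.normal_span_Irr fmul_fw_in_IrrS) auto
next
  case (normal_span_word p q)
  then show ?case using normal_span_letter_word[OF assms(2), of p q] by simp
qed (auto simp: fmul_add_right fmul_fsc_right intro: normal_span.intros)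

lemma word_normal_span: "set w \<subseteq> beta_prop n \<Longrightarrow> fw w \<in> normal_span n (\<Sum>x\<leftarrow>w. vdeg x)"
proof (induction w)
  case Nil
  show ?case using normal_span_word[of "[]" n "[]" 0] by simp
next
  case (Cons x w)
  then have "fmul (fw [x]) (fw w) \<in> normal_span n ((\<Sum>x\<leftarrow>w. vdeg x) + vdeg x)"
    by (intro normal_span_letter) auto
  then show ?case by (simp add: add.commute)
qed

text \<open>In degree zero the virtual part of a normal word is empty. The choice in
  \<open>proj\<close> relies on this.\<close>

lemma normal_span_0: "f \<in> normal_span n k \<Longrightarrow> k = 0 \<Longrightarrow> \<exists>u\<in>GLW n. f - u \<in> IrrS n"
proof (induction rule: normal_span.induct)
  case (normal_span_Irr p)
  then show ?case by (intro bexI[of _ 0]) auto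
next
  case (normal_span_word p q)
  then show ?case
    by (intro bexI[of _ "fw (p @ q)"]) (auto intro: fw_GLW IrrS_UId UId_zero)
next
  case (normal_span_add f g)
  then obtain u v where "u \<in> GLW n" "v \<in> GLW n" "f - u \<in> IrrS n" "g - v \<in> IrrS n" by blast
  then show ?case using IrrS_add[of "f - u" n "g - v"]
    by (intro bexI[of _ "u + v"]) (auto intro: GLW_add simp: algebra_simps)
next
  case (normal_span_smult f c)
  then obtain u where "u \<in> GLW n" "f - u \<in> IrrS n" by blast
  then show ?case using IrrS_smult[of "f - u" n c]
    by (intro bexI[of _ "fsc c u"]) (auto intro: GLW_smult simp: fsc_diff)
qed

lemma proj_word:
  assumes "set w \<subseteq> beta_prop n" "(\<Sum>x\<leftarrow>w. vdeg x) = 0"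
  shows "proj n (fw w) \<in> GLW n" "fw w - proj n (fw w) \<in> IrrS n"
proof -
  have "\<exists>u. u \<in> GLW n \<and> fw w - u \<in> IrrS n"
    using normal_span_0[OF word_normal_span[OF assms(1)] assms(2)] by blast
  then have "proj n (fw w) \<in> GLW n \<and> fw w - proj n (fw w) \<in> IrrS n"
    unfolding proj_def by (rule someI_ex)
  then show "proj n (fw w) \<in> GLW n" "fw w - proj n (fw w) \<in> IrrS n" by auto
qed

lemma sum_list_map_concat: "(\<Sum>x\<leftarrow>concat xss. f x) = (\<Sum>xs\<leftarrow>xss. \<Sum>x\<leftarrow>xs. f x :: int)"
  by (induction xss) auto

lemma capelli_word:
  assumes "young_tableau n S" "young_tableau n T" "shape S = shape T"
  shows "set (e_SD S @ e_DT T) \<subseteq> beta_prop n" "(\<Sum>x\<leftarrow>e_SD S @ e_DT T. vdeg x) = 0"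
proof -
  have "(\<Sum>x\<leftarrow>e_SD S. vdeg x) = - (\<Sum>r\<leftarrow>[0..<length S]. int (length (S ! r)))"
    by (simp add: e_SD_def sum_list_map_concat comp_def vdeg_def sum_list_triv uminus_sum_list_map)
  moreover have "(\<Sum>x\<leftarrow>e_DT T. vdeg x) = (\<Sum>r\<leftarrow>[0..<length T]. int (length (T ! r)))"
    by (simp add: e_DT_def sum_list_map_concat comp_def vdeg_def sum_list_triv)
  moreover have len: "length S = length T" using arg_cong[OF assms(3), of length] by (simp add: shape_def)
  moreover have "length (S ! r) = length (T ! r)" if "r < length S" for r
    using arg_cong[OF assms(3), of "\<lambda>xs. xs ! r"] that len by (simp add: shape_def)
  then have "(\<Sum>r\<leftarrow>[0..<length S]. int (length (S ! r))) = (\<Sum>r\<leftarrow>[0..<length S]. int (length (T ! r)))"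
    by (intro arg_cong[of _ _ sum_list] map_cong) auto
  ultimately show "(\<Sum>x\<leftarrow>e_SD S @ e_DT T. vdeg x) = 0" by simp
  show "set (e_SD S @ e_DT T) \<subseteq> beta_prop n"
  proof -
    have "x \<in> beta_prop n" if x: "x \<in> set (e_SD S)" for x
    proof -
      obtain r s where "r < length S" "s \<in> set (S ! r)" "x = (Prop s, Beta (Suc r))"
        using x by (auto simp: e_SD_def)
      moreover then have "s \<in> {1..n}" using assms(1) nth_mem[of r S] unfolding young_tableau_def by blast
      ultimately show ?thesis by (simp add: beta_prop_def)
    qed
    moreover have "x \<in> beta_prop n" if x: "x \<in> set (e_DT T)" for x
    proof -
      obtain r s where "r < length T" "s \<in> set (T ! r)" "x = (Beta (Suc r), Prop s)"
        using x by (auto simp: e_DT_def)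
      moreover then have "s \<in> {1..n}" using assms(2) nth_mem[of r T] unfolding young_tableau_def by blast
      ultimately show ?thesis by (simp add: beta_prop_def)
    qed
    ultimately have "set (e_SD S) \<subseteq> beta_prop n" "set (e_DT T) \<subseteq> beta_prop n" by auto
    then show ?thesis by simp
  qed
qed

lemma
  assumes "young_tableau n S" "young_tableau n T" "shape S = shape T"
  shows capelli_GLW: "capelli_bitab n S T \<in> GLW n"
    and capelli_act: "\<forall>s\<in>set l. \<not> virtual s \<Longrightarrow>
      fa_act (capelli_bitab n S T) g l = word_act (e_DT T) (word_act (e_SD S) g) l"
proof -
  note w = proj_word[OF capelli_word[OF assms]]
  show "capelli_bitab n S T \<in> GLW n" using w(1) by (simp add: capelli_bitab_def)
  assume "\<forall>s\<in>set l. \<not> virtual s"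
  then have "fa_act (fw (e_SD S @ e_DT T) - proj n (fw (e_SD S @ e_DT T))) g l = 0"
    by (rule IrrS_act[OF w(2)])
  then show "fa_act (capelli_bitab n S T) g l = word_act (e_DT T) (word_act (e_SD S) g) l"
    by (simp add: capelli_bitab_def word_act_append)
qed

section \<open>Permanents\<close>

definition prop_letter :: "nat \<times> nat \<Rightarrow> letter" where
  "prop_letter x = (Prop (fst x), Prop (snd x))"

definition exponent_of :: "(nat \<times> nat) list \<Rightarrow> (nat \<times> nat) \<Rightarrow>\<^sub>0 nat" where
  "exponent_of xs = (\<Sum>x\<leftarrow>xs. sngl x 1)"

lemma coef_exponent_of: "coef (exponent_of xs) x = count (mset xs) x"
  by (induction xs) (auto simp: exponent_of_def lookup_add lookup_single when_def)

text \<open>The order of the list is immaterial for normal ordered products; in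
  \<open>bitab_map\<close> it selects one of the possible pairs of columns.\<close>

definition enum :: "((nat \<times> nat) \<Rightarrow>\<^sub>0 nat) \<Rightarrow> (nat \<times> nat) list" where
  "enum m = (SOME xs. exponent_of xs = m)"

lemma exponent_of_enum [simp]: "exponent_of (enum m) = m"
  unfolding enum_def
proof (rule someI_ex)
  obtain xs where xs: "mset xs = Abs_multiset (coef m)" using ex_mset by blast
  have "finite {x. 0 < coef m x}"
    using finite_keys[of m] by (simp add: keys.rep_eq)
  then have "exponent_of xs = m"
    by (intro poly_mapping_eqI) (simp add: coef_exponent_of xs count_Abs_multiset)
  then show "\<exists>xs. exponent_of xs = m" ..
qed

lemma mset_enum: "mset (enum (exponent_of xs)) = mset xs"
  by (rule multiset_eqI) (metis coef_exponent_of exponent_of_enum)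

lemma set_enum: "set (enum m) = supp m"
proof -
  have "x \<in> set (enum m) \<longleftrightarrow> coef (exponent_of (enum m)) x \<noteq> 0" for x
    unfolding coef_exponent_of by simp
  then show ?thesis by (auto simp: in_keys_iff)
qed

lemma exponent_of_append: "exponent_of (xs @ ys) = exponent_of xs + exponent_of ys"
  by (simp add: exponent_of_def)

lemma single_exponent_append:
  "sngl (exponent_of (xs @ ys)) (1::complex) = sngl (exponent_of xs) 1 * sngl (exponent_of ys) 1"
  by (simp add: exponent_of_append mult_single)

lemma prod_pvar: "(\<Prod>r<p. pvar (a r) (b r)) = sngl (exponent_of (map (\<lambda>r. (a r, b r)) [0..<p])) 1"
proof (induction p)
  case 0
  show ?case by (simp add: exponent_of_def)
next
  case (Suc p)
  have "pvar (a p) (b p) = sngl (exponent_of [(a p, b p)]) 1"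
    by (simp add: pvar_def exponent_of_def)
  then show ?case by (simp add: Suc single_exponent_append)
qed

text \<open>Linear in \<open>p\<close> by construction, this is the operator through which both
  sides of the identity act on proper tensors.\<close>

definition poly_act :: "mpoly \<Rightarrow> (sym list \<Rightarrow> complex) \<Rightarrow> sym list \<Rightarrow> complex" where
  "poly_act p g l = linext (\<lambda>m. normal_ord (image_mset prop_letter (mset (enum m))) g l) p"

lemma poly_act_monomial:
  "poly_act (sngl (exponent_of xs) 1) g l = normal_ord (image_mset prop_letter (mset xs)) g l"
  by (simp add: poly_act_def mset_enum)

lemma poly_act_sum: "poly_act (sum F A) g l = (\<Sum>i\<in>A. poly_act (F i) g l)"
  by (simp add: poly_act_def)

section \<open>Contraction of the virtual symbols, row by row\<close>

lemma normal_ord_letter_act_beta: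
  assumes "Beta b \<notin> set l"
  shows "normal_ord M (letter_act (Prop s, Beta b) g) l
    = (\<Sum>y\<in>#M. if fst y = Beta b then normal_ord (add_mset (Prop s, snd y) (M - {#y#})) g l else 0)"
proof -
  have "lpar (Prop s, Beta b) = 0" by (simp add: lpar_def)
  moreover have "normal_ord (add_mset (Prop s, Beta b) M) g l = 0"
    by (rule normal_ord_notin[of "(Prop s, Beta b)"]) (use assms in auto)
  ultimately show ?thesis by (simp add: normal_ord_letter_act cong: if_cong)
qed

text \<open>The transposition of \<open>p\<close> and \<open>k\<close> moves the deleted entry to
  the last index. This reindexing and the form of the bound on \<open>k\<close> match
  \<open>sum_over_permutations_insert\<close>, which writes a permutation as
  \<open>transpose p k \<circ> q\<close>.\<close>

lemma remove_transposed:
  fixes Y :: "nat \<Rightarrow> 'a"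
  assumes "k \<in> insert p {..<p}"
  shows "image_mset Y (mset_set {..<Suc p}) - {#Y k#} = image_mset (\<lambda>j. Y (transpose p k j)) (mset_set {..<p})"
proof -
  have "transpose p k permutes {..<Suc p}"
    using assms by (intro permutes_swap_id) auto
  then have "mset_set {..<Suc p} = image_mset (transpose p k) (mset_set {..<Suc p})"
    by (simp only: image_mset_mset_set permutes_inj_on permutes_image)
  then have "image_mset Y (mset_set {..<Suc p}) = image_mset Y (image_mset (transpose p k) (mset_set {..<Suc p}))"
    by (rule arg_cong)
  also have "\<dots> = add_mset (Y k) (image_mset (\<lambda>j. Y (transpose p k j)) (mset_set {..<p}))"
    by (simp add: lessThan_Suc image_mset.compositionality comp_def)
  finally show ?thesis by simp
qed

text \<open>The last factor e_{s,\<beta>} of the row stands next to the normal ordered product. On a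
  tensor free of \<beta> it acts only by contraction, with any of the letters that create \<beta>;
  the other factors follow by induction. The choices together form a permutation. \<open>N\<close>
  holds the letters of other rows and those already contracted.\<close>

lemma row_contraction:
  assumes "\<forall>y\<in>#N. fst y \<noteq> Beta b" "Beta b \<notin> set l"
  shows "normal_ord (N + image_mset (\<lambda>k. (Beta b, Prop (t k))) (mset_set {..<p}))
      (word_act (map (\<lambda>r. (Prop (s r), Beta b)) [0..<p]) g) l
    = (\<Sum>\<sigma> | \<sigma> permutes {..<p}. normal_ord (N + image_mset (\<lambda>k. (Prop (s k), Prop (t (\<sigma> k)))) (mset_set {..<p})) g l)"
  using assms(1)
proof (induction p arbitrary: N t)
  case 0
  then show ?case by (simp add: permutes_empty)
next
  case (Suc p)
  define Y where "Y k = (Beta b, Prop (t k))" for k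
  define h where "h = word_act (map (\<lambda>r. (Prop (s r), Beta b)) [0..<p]) g"
  let ?M = "N + image_mset Y (mset_set {..<Suc p})"
  let ?F = "\<lambda>\<sigma>. normal_ord (N + image_mset (\<lambda>k. (Prop (s k), Prop (t (\<sigma> k)))) (mset_set {..<Suc p})) g l"
  have "normal_ord ?M (word_act (map (\<lambda>r. (Prop (s r), Beta b)) [0..<Suc p]) g) l
      = normal_ord ?M (letter_act (Prop (s p), Beta b) h) l"
    by (simp add: word_act_append h_def)
  also have "\<dots> = (\<Sum>y\<in>#?M. if fst y = Beta b then normal_ord (add_mset (Prop (s p), snd y) (?M - {#y#})) h l else 0)"
    by (rule normal_ord_letter_act_beta[OF assms(2)])
  also have "\<dots> = (\<Sum>y\<in>#N. if fst y = Beta b then normal_ord (add_mset (Prop (s p), snd y) (?M - {#y#})) h l else 0)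
     + (\<Sum>k<Suc p. normal_ord (add_mset (Prop (s p), Prop (t k)) (?M - {#Y k#})) h l)"
    by (simp add: sum_unfold_sum_mset image_mset.compositionality comp_def Y_def)
  also have "(\<Sum>y\<in>#N. if fst y = Beta b then normal_ord (add_mset (Prop (s p), snd y) (?M - {#y#})) h l else 0) = (\<Sum>y\<in>#N. 0)"
    using Suc.prems by (intro sum_mset_cong) auto
  also have "(\<Sum>y\<in>#N. 0) + (\<Sum>k<Suc p. normal_ord (add_mset (Prop (s p), Prop (t k)) (?M - {#Y k#})) h l)
     = (\<Sum>k\<in>insert p {..<p}. normal_ord (add_mset (Prop (s p), Prop (t k)) (?M - {#Y k#})) h l)"
    by (simp add: lessThan_Suc)
  also have "\<dots> = (\<Sum>k\<in>insert p {..<p}. \<Sum>q | q permutes {..<p}. ?F (transpose p k \<circ> q))"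
  proof (intro sum.cong refl)
    fix k assume k: "k \<in> insert p {..<p}"
    then have "Y k \<in># image_mset Y (mset_set {..<Suc p})" by (auto simp: lessThan_Suc)
    then have "?M - {#Y k#} = N + (image_mset Y (mset_set {..<Suc p}) - {#Y k#})"
      by (rule diff_union_single_conv)
    also have "\<dots> = N + image_mset (\<lambda>j. Y (transpose p k j)) (mset_set {..<p})"
      by (simp only: remove_transposed[OF k])
    finally have M: "add_mset (Prop (s p), Prop (t k)) (?M - {#Y k#})
        = add_mset (Prop (s p), Prop (t k)) N + image_mset (\<lambda>j. (Beta b, Prop (t (transpose p k j)))) (mset_set {..<p})"
      by (simp add: Y_def)
    have "normal_ord (add_mset (Prop (s p), Prop (t k)) (?M - {#Y k#})) h l
      = (\<Sum>q | q permutes {..<p}. normal_ord (add_mset (Prop (s p), Prop (t k)) N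
          + image_mset (\<lambda>j. (Prop (s j), Prop (t (transpose p k (q j))))) (mset_set {..<p})) g l)"
      unfolding M h_def by (rule Suc.IH) (use Suc.prems in auto)
    also have "\<dots> = (\<Sum>q | q permutes {..<p}. ?F (transpose p k \<circ> q))"
    proof (intro sum.cong refl)
      fix q assume "q \<in> {q. q permutes {..<p}}"
      \<comment> \<open>As \<open>q\<close> fixes \<open>p\<close>, the new pair is the term of
        index \<open>p\<close> in \<open>?F (transpose p k \<circ> q)\<close>.\<close>
      then have "q p = p" by (auto simp: permutes_def)
      then show "normal_ord (add_mset (Prop (s p), Prop (t k)) N
          + image_mset (\<lambda>j. (Prop (s j), Prop (t (transpose p k (q j))))) (mset_set {..<p})) g l = ?F (transpose p k \<circ> q)"
        by (simp add: lessThan_Suc)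
    qed
    finally show "normal_ord (add_mset (Prop (s p), Prop (t k)) (?M - {#Y k#})) h l
      = (\<Sum>q | q permutes {..<p}. ?F (transpose p k \<circ> q))" .
  qed
  also have "\<dots> = (\<Sum>\<sigma> | \<sigma> permutes insert p {..<p}. ?F \<sigma>)"
    by (rule sum_over_permutations_insert[symmetric]) auto
  finally show ?case by (simp only: Y_def lessThan_Suc)
qed

text \<open>Rows are contracted from the last to the first, since the last row of e_{S,D'} stands
  next to e_{D',T}; \<open>xs\<close> records the pairs produced so far. Each row has its own
  \<beta>, so contractions stay inside a row.\<close>

lemma rows_contraction:
  assumes l: "\<forall>s\<in>set l. \<not> virtual s" and "\<forall>r<m. length (S ! r) = length (T ! r)"
  shows "normal_ord (image_mset prop_letter (mset xs)
        + mset (concat (map (\<lambda>r. map (\<lambda>t. (Beta (Suc r), Prop t)) (T ! r)) [0..<m])))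
      (word_act (concat (map (\<lambda>r. map (\<lambda>s. (Prop s, Beta (Suc r))) (S ! r)) [0..<m])) g) l
    = poly_act (sngl (exponent_of xs) 1 * (\<Prod>r<m. per_biprod (S ! r) (T ! r))) g l"
  using assms(2)
proof (induction m arbitrary: xs)
  case 0
  then show ?case by (simp add: poly_act_monomial)
next
  case (Suc m)
  define DT where "DT = mset (concat (map (\<lambda>r. map (\<lambda>t. (Beta (Suc r), Prop t)) (T ! r)) [0..<m]))"
  define SD where "SD = concat (map (\<lambda>r. map (\<lambda>s. (Prop s, Beta (Suc r))) (S ! r)) [0..<m])"
  define p where "p = length (S ! m)"
  define N where "N = image_mset prop_letter (mset xs) + DT"
  define zs where "zs \<sigma> = map (\<lambda>k. (S ! m ! k, T ! m ! \<sigma> k)) [0..<p]" for \<sigma>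
  have T: "map f (T ! m) = map (\<lambda>k. f (T ! m ! k)) [0..<p]" for f :: "nat \<Rightarrow> letter"
    using Suc.prems by (intro nth_equalityI) (auto simp: p_def)
  have S: "map f (S ! m) = map (\<lambda>k. f (S ! m ! k)) [0..<p]" for f :: "nat \<Rightarrow> letter"
    by (intro nth_equalityI) (auto simp: p_def)
  have mset_upt: "mset [0..<p] = mset_set {..<p}" by (simp add: atLeast0LessThan)
  \<comment> \<open>The rows still to be treated create only \<open>Beta 1\<close> to
    \<open>Beta m\<close>.\<close>
  have N: "\<forall>y\<in>#N. fst y \<noteq> Beta (Suc m)" by (auto simp: N_def DT_def prop_letter_def)
  have "normal_ord (image_mset prop_letter (mset xs)
        + mset (concat (map (\<lambda>r. map (\<lambda>t. (Beta (Suc r), Prop t)) (T ! r)) [0..<Suc m])))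
      (word_act (concat (map (\<lambda>r. map (\<lambda>s. (Prop s, Beta (Suc r))) (S ! r)) [0..<Suc m])) g) l
     = normal_ord (N + image_mset (\<lambda>k. (Beta (Suc m), Prop (T ! m ! k))) (mset_set {..<p}))
       (word_act (map (\<lambda>k. (Prop (S ! m ! k), Beta (Suc m))) [0..<p]) (word_act SD g)) l"
    by (simp add: word_act_append SD_def[symmetric] DT_def[symmetric] N_def add.assoc T S mset_upt[symmetric])
  also have "\<dots> = (\<Sum>\<sigma> | \<sigma> permutes {..<p}. normal_ord (N + image_mset (\<lambda>k. (Prop (S ! m ! k), Prop (T ! m ! \<sigma> k))) (mset_set {..<p})) (word_act SD g) l)"
    by (rule row_contraction[OF N]) (use l in auto)
  also have "\<dots> = (\<Sum>\<sigma> | \<sigma> permutes {..<p}. normal_ord (image_mset prop_letter (mset (xs @ zs \<sigma>)) + DT) (word_act SD g) l)"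
    by (intro sum.cong refl) (simp add: N_def zs_def mset_upt[symmetric] image_mset.compositionality comp_def prop_letter_def add_ac)
  also have "\<dots> = (\<Sum>\<sigma> | \<sigma> permutes {..<p}. poly_act (sngl (exponent_of (xs @ zs \<sigma>)) 1 * (\<Prod>r<m. per_biprod (S ! r) (T ! r))) g l)"
    unfolding DT_def SD_def using Suc.prems by (intro sum.cong refl Suc.IH) auto
  also have "\<dots> = poly_act (\<Sum>\<sigma> | \<sigma> permutes {..<p}. sngl (exponent_of xs) 1 * sngl (exponent_of (zs \<sigma>)) 1 * (\<Prod>r<m. per_biprod (S ! r) (T ! r))) g l"
    by (simp add: poly_act_sum single_exponent_append)
  also have "(\<Sum>\<sigma> | \<sigma> permutes {..<p}. sngl (exponent_of xs) 1 * sngl (exponent_of (zs \<sigma>)) 1 * (\<Prod>r<m. per_biprod (S ! r) (T ! r)))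
    = sngl (exponent_of xs) 1 * ((\<Prod>r<m. per_biprod (S ! r) (T ! r)) * per_biprod (S ! m) (T ! m))"
    unfolding per_biprod_def[of "S ! m"] p_def[symmetric] prod_pvar zs_def
    by (simp add: sum_distrib_left sum_distrib_right mult_ac)
  finally show ?case by simp
qed

lemma bitableau_act:
  assumes "shape S = shape T" "\<forall>s\<in>set l. \<not> virtual s"
  shows "word_act (e_DT T) (word_act (e_SD S) g) l = poly_act (star_bitab S T) g l"
proof -
  have len: "length S = length T" using arg_cong[OF assms(1), of length] by (simp add: shape_def)
  have "\<forall>r<length S. length (S ! r) = length (T ! r)"
    using arg_cong[OF assms(1), of "\<lambda>xs. xs ! r" for r] len by (metis nth_map shape_def)
  then have "normal_ord (image_mset prop_letter (mset []) + mset (e_DT T)) (word_act (e_SD S) g) l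
    = poly_act (sngl (exponent_of []) 1 * star_bitab S T) g l"
    unfolding e_DT_def e_SD_def star_bitab_def len[symmetric] by (rule rows_contraction[OF assms(2)])
  moreover have "word_act (e_DT T) h l = normal_ord (mset (e_DT T)) h l" for h
    by (rule word_act_noncontracting) (auto simp: e_DT_def lpar_def)
  ultimately show ?thesis by (simp add: exponent_of_def)
qed

section \<open>The map from polynomials to the enveloping algebra\<close>

definition col_left :: "(nat \<times> nat) list \<Rightarrow> nat list list" where
  "col_left xs = map (\<lambda>x. [fst x]) xs"

definition col_right :: "(nat \<times> nat) list \<Rightarrow> nat list list" where
  "col_right xs = map (\<lambda>x. [snd x]) xs"

lemma star_bitab_col: "star_bitab (col_left xs) (col_right xs) = sngl (exponent_of xs) 1"
proof -
  have "per_biprod [i] [j] = pvar i j" for i j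
    by (simp add: per_biprod_def lessThan_Suc permutes_sing)
  then have "star_bitab (col_left xs) (col_right xs) = (\<Prod>r<length xs. pvar (fst (xs ! r)) (snd (xs ! r)))"
    by (simp add: star_bitab_def col_left_def col_right_def)
  also have "\<dots> = sngl (exponent_of xs) 1" by (simp add: prod_pvar map_nth)
  finally show ?thesis .
qed

lemma sorted_wrt_ge_replicate: "sorted_wrt (\<ge>) (map (\<lambda>x. k :: nat) xs)"
  by (induction xs) auto

lemma young_tableau_col:
  assumes "set xs \<subseteq> {1..n} \<times> {1..n}"
  shows "young_tableau n (col_left xs)" "young_tableau n (col_right xs)"
  using assms by (auto simp: young_tableau_def col_left_def col_right_def comp_def sorted_wrt_ge_replicate)

lemma shape_col: "shape (col_left xs) = shape (col_right xs)"
  by (simp add: shape_def col_left_def col_right_def comp_def)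

section \<open>Closure properties of the polynomial algebra\<close>

lemma Pn_add: "p \<in> Pn n \<Longrightarrow> q \<in> Pn n \<Longrightarrow> p + q \<in> Pn n"
  unfolding Pn_def using Poly_Mapping.keys_add[of p q] by blast

lemma Pn_zero: "0 \<in> Pn n"
  by (simp add: Pn_def)

lemma Pn_one: "1 \<in> Pn n"
  by (simp add: Pn_def)

lemma Pn_sum: "(\<And>i. i \<in> A \<Longrightarrow> F i \<in> Pn n) \<Longrightarrow> sum F A \<in> Pn n"
  by (induction A rule: infinite_finite_induct) (auto intro: Pn_add Pn_zero)

lemma Pn_mult:
  assumes "p \<in> Pn n" "q \<in> Pn n"
  shows "p * q \<in> Pn n"
  unfolding Pn_def
proof (intro CollectI ballI)
  fix m assume "m \<in> supp (p * q)"
  then obtain a b where "m = a + b" "a \<in> supp p" "b \<in> supp q" using keys_mult[of p q] by blast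
  moreover have "supp (a + b) \<subseteq> supp a \<union> supp b" by (rule Poly_Mapping.keys_add)
  ultimately show "supp m \<subseteq> {1..n} \<times> {1..n}" using assms unfolding Pn_def by blast
qed

lemma Pn_prod: "(\<And>i. i \<in> A \<Longrightarrow> F i \<in> Pn n) \<Longrightarrow> prod F A \<in> Pn n"
  by (induction A rule: infinite_finite_induct) (auto intro: Pn_mult Pn_one)

lemma star_bitab_Pn:
  assumes "young_tableau n S" "young_tableau n T" "shape S = shape T"
  shows "star_bitab S T \<in> Pn n"
  unfolding star_bitab_def per_biprod_def
proof (intro Pn_prod Pn_sum)
  fix r \<sigma> k assume r: "r \<in> {..<length S}" and \<sigma>: "\<sigma> \<in> {\<sigma>. \<sigma> permutes {..<length (S ! r)}}"
    and k: "k \<in> {..<length (S ! r)}"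
  have len: "length S = length T" using arg_cong[OF assms(3), of length] by (simp add: shape_def)
  have "length (S ! r) = length (T ! r)"
    using assms(3) r len by (metis lessThan_iff nth_map shape_def)
  moreover have "\<sigma> k < length (S ! r)" using \<sigma> k by (simp add: permutes_nat_less permutes_in_image[of \<sigma> "{..<length (S ! r)}" k, simplified])
  ultimately have "T ! r ! \<sigma> k \<in> set (T ! r)" "S ! r ! k \<in> set (S ! r)" using k by auto
  moreover have "T ! r \<in> set T" "S ! r \<in> set S" using r len by auto
  ultimately have "T ! r ! \<sigma> k \<in> {1..n}" "S ! r ! k \<in> {1..n}"
    using assms(1,2) unfolding young_tableau_def by blast+
  then show "pvar (S ! r ! k) (T ! r ! \<sigma> k) \<in> Pn n" by (simp add: Pn_def pvar_def)
qed

text \<open>Defined on the basis of monomials through single columns, the map is linear exactly and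
  not just modulo \<open>UId n\<close>. The content lies in its values on all other bitableaux,
  \<open>bitab_map_star_bitab\<close>.\<close>

definition bitab_map :: "nat \<Rightarrow> mpoly \<Rightarrow> fa" where
  "bitab_map n p = (\<Sum>m\<in>supp p. fsc (coef p m) (capelli_bitab n (col_left (enum m)) (col_right (enum m))))"

lemma bitab_map_superset:
  "finite A \<Longrightarrow> supp p \<subseteq> A \<Longrightarrow>
    bitab_map n p = (\<Sum>m\<in>A. fsc (coef p m) (capelli_bitab n (col_left (enum m)) (col_right (enum m))))"
  unfolding bitab_map_def by (intro sum.mono_neutral_left) (auto simp: in_keys_iff)

lemma bitab_map_add: "bitab_map n (p + q) = bitab_map n p + bitab_map n q"
proof -
  have "supp (p + q) \<subseteq> supp p \<union> supp q" by (rule Poly_Mapping.keys_add)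
  then show ?thesis
    by (simp add: bitab_map_superset[of "supp p \<union> supp q"] lookup_add fsc_add_left sum.distrib)
qed

lemma bitab_map_psmult: "bitab_map n (psmult c p) = fsc c (bitab_map n p)"
proof -
  have "supp (psmult c p) \<subseteq> supp p" by (auto simp: in_keys_iff psmult_def coef_scale)
  then show ?thesis
    by (simp add: bitab_map_superset[of "supp p"] psmult_def coef_scale fsc_sum)
qed

lemma enum_Pn: "p \<in> Pn n \<Longrightarrow> m \<in> supp p \<Longrightarrow> set (enum m) \<subseteq> {1..n} \<times> {1..n}"
  by (simp add: set_enum Pn_def)

lemma bitab_map_GLW: "p \<in> Pn n \<Longrightarrow> bitab_map n p \<in> GLW n"
  unfolding bitab_map_def
  by (intro GLW_sum GLW_smult capelli_GLW young_tableau_col shape_col enum_Pn)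

lemma bitab_map_act:
  assumes "p \<in> Pn n" "\<forall>s\<in>set l. \<not> virtual s"
  shows "fa_act (bitab_map n p) g l = poly_act p g l"
proof -
  have "fa_act (capelli_bitab n (col_left (enum m)) (col_right (enum m))) g l
     = normal_ord (image_mset prop_letter (mset (enum m))) g l" if "m \<in> supp p" for m
    using young_tableau_col[OF enum_Pn[OF assms(1) that]] shape_col assms(2)
    by (simp only: capelli_act bitableau_act star_bitab_col poly_act_monomial)
  then show ?thesis by (simp add: bitab_map_def poly_act_def linext_def)
qed

lemma bitab_map_star_bitab:
  assumes "young_tableau n S" "young_tableau n T" "shape S = shape T"
  shows "bitab_map n (star_bitab S T) - capelli_bitab n S T \<in> UId n"
proof (rule GLW_act_faithful)
  have P: "star_bitab S T \<in> Pn n" by (rule star_bitab_Pn[OF assms])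
  show "bitab_map n (star_bitab S T) - capelli_bitab n S T \<in> GLW n"
    by (intro GLW_diff bitab_map_GLW P capelli_GLW assms)
  fix g l assume "set l \<subseteq> range Prop"
  then have "\<forall>s\<in>set l. \<not> virtual s" by auto
  then show "fa_act (bitab_map n (star_bitab S T) - capelli_bitab n S T) g l = 0"
    by (simp add: bitab_map_act[OF P] capelli_act[OF assms] bitableau_act[OF assms(3)])
qed

text \<open>\<open>B\<close> is linear only modulo \<open>UId n\<close>, so the expansion adds one
  monomial at a time and accumulates the errors in the ideal.\<close>

lemma lin_to_Ugl_expand:
  assumes B: "lin_to_Ugl n B" and p: "p \<in> Pn n"
  shows "B p - (\<Sum>m\<in>supp p. fsc (coef p m) (B (sngl m 1))) \<in> UId n"
proof -
  have add: "\<And>p q. p \<in> Pn n \<Longrightarrow> q \<in> Pn n \<Longrightarrow> B (p + q) - (B p + B q) \<in> UId n"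
    and sc: "\<And>c p. p \<in> Pn n \<Longrightarrow> B (psmult c p) - fsc c (B p) \<in> UId n"
    using B unfolding lin_to_Ugl_def by blast+
  have single: "sngl m c \<in> Pn n" if "m \<in> supp p" for m c
    using p that by (auto simp: Pn_def)
  have "B (\<Sum>m\<in>A. sngl m (coef p m)) - (\<Sum>m\<in>A. fsc (coef p m) (B (sngl m 1))) \<in> UId n"
    if "finite A" "A \<subseteq> supp p" for A
    using that
  proof (induction A rule: finite_induct)
    case empty
    \<comment> \<open>The instance 0 + 0 of additivity reads
      \<open>- B 0 \<in> UId n\<close>.\<close>
    show ?case using UId_uminus[OF add[OF Pn_zero Pn_zero]] by simp
  next
    case (insert m A)
    let ?s = "\<Sum>m\<in>A. sngl m (coef p m)" and ?t = "\<Sum>m\<in>A. fsc (coef p m) (B (sngl m 1))"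
    have 1: "B (sngl m (coef p m) + ?s) - (B (sngl m (coef p m)) + B ?s) \<in> UId n"
      using insert.prems by (intro add Pn_sum single) auto
    have "psmult (coef p m) (sngl m 1) = sngl m (coef p m)"
      by (rule poly_mapping_eqI) (simp add: psmult_def coef_scale lookup_single when_def)
    then have 2: "B (sngl m (coef p m)) - fsc (coef p m) (B (sngl m 1)) \<in> UId n"
      using sc[OF single[of m 1], of "coef p m"] insert.prems by simp
    have 3: "B ?s - ?t \<in> UId n" using insert by blast
    have "B (sngl m (coef p m) + ?s) - (fsc (coef p m) (B (sngl m 1)) + ?t) =
      (B (sngl m (coef p m) + ?s) - (B (sngl m (coef p m)) + B ?s))
      + ((B (sngl m (coef p m)) - fsc (coef p m) (B (sngl m 1))) + (B ?s - ?t))"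
      by (simp add: algebra_simps)
    also have "\<dots> \<in> UId n" by (intro UId_add 1 2 3)
    finally show ?case using insert.hyps by simp
  qed
  from this[of "supp p"] show ?thesis using sum_monomials[of p] by simp
qed

theorem mainTheorem2:
  fixes n :: nat
  shows "\<exists>B. lin_to_Ugl n B \<and>
     (\<forall>S T. young_tableau n S \<and> young_tableau n T \<and> shape S = shape T \<longrightarrow>
         B (star_bitab S T) - capelli_bitab n S T \<in> UId n) \<and>
     (\<forall>B'. lin_to_Ugl n B' \<and>
         (\<forall>S T. young_tableau n S \<and> young_tableau n T \<and> shape S = shape T \<longrightarrow>
            B' (star_bitab S T) - capelli_bitab n S T \<in> UId n)
       \<longrightarrow> (\<forall>p \<in> Pn n. B' p - B p \<in> UId n))"
proof (intro exI[of _ "bitab_map n"] conjI allI impI ballI)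
  show "lin_to_Ugl n (bitab_map n)"
    by (simp add: lin_to_Ugl_def bitab_map_GLW bitab_map_add bitab_map_psmult UId_zero)
  show "bitab_map n (star_bitab S T) - capelli_bitab n S T \<in> UId n"
    if "young_tableau n S \<and> young_tableau n T \<and> shape S = shape T" for S T
    using that by (intro bitab_map_star_bitab) auto
  fix B' p
  assume B': "lin_to_Ugl n B' \<and>
         (\<forall>S T. young_tableau n S \<and> young_tableau n T \<and> shape S = shape T \<longrightarrow>
            B' (star_bitab S T) - capelli_bitab n S T \<in> UId n)" and p: "p \<in> Pn n"
  \<comment> \<open>The values forced on monomials: by \<open>star_bitab_col\<close> the monomial m
    is the bitableau of these two columns.\<close>
  let ?C = "\<lambda>m. capelli_bitab n (col_left (enum m)) (col_right (enum m))"
  have "B' (sngl m 1) - ?C m \<in> UId n" if "m \<in> supp p" for m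
    using B' young_tableau_col[OF enum_Pn[OF p that]] shape_col[of "enum m"]
    by (metis star_bitab_col exponent_of_enum)
  then have "(\<Sum>m\<in>supp p. fsc (coef p m) (B' (sngl m 1) - ?C m)) \<in> UId n"
    by (intro UId_sum UId_smult)
  moreover have "B' p - (\<Sum>m\<in>supp p. fsc (coef p m) (B' (sngl m 1))) \<in> UId n"
    using B' p by (intro lin_to_Ugl_expand) auto
  ultimately have "(B' p - (\<Sum>m\<in>supp p. fsc (coef p m) (B' (sngl m 1))))
     + (\<Sum>m\<in>supp p. fsc (coef p m) (B' (sngl m 1) - ?C m)) \<in> UId n"
    by (intro UId_add)
  also have "(B' p - (\<Sum>m\<in>supp p. fsc (coef p m) (B' (sngl m 1))))
     + (\<Sum>m\<in>supp p. fsc (coef p m) (B' (sngl m 1) - ?C m)) = B' p - bitab_map n p"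
    by (simp add: bitab_map_def fsc_diff sum_subtractf)
  finally show "B' p - bitab_map n p \<in> UId n" .
qed

end
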